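(* Let $L$ be a field, $A$ a central simple $L$-algebra with $\dim_L A=n^2$, $\tau$ an involution of $A$, and $E$ an $n$-dimensional commutative étale $L$-algebra with a ring automorphism $\sigma$ of order two such that $\sigma(L)=L$, $\sigma|_L=\tau|_L$, and condition (I1) holds; put $F=E^\sigma$. Let $\varepsilon\colon E\hookrightarrow A$ be an $L$-embedding (not necessarily respecting involutions), and let $g\in A^\times$ with $\tau(g)=g$ be such that $\varepsilon(\sigma(x))=g^{-1}\tau(\varepsilon(x))g$ for all $x\in E$. For $a\in F^\times$ let $\theta_a=\tau\circ\mathrm{Int}(g\varepsilon(a))$, where $\mathrm{Int}(y)(z)=yzy^{-1}$. Then the following are equivalent: (i) there exists an $L$-embedding $\iota\colon(E,\sigma)\hookrightarrow(A,\tau)$ of algebras with involution; (ii) there exists $a\in F^\times$ such that $(A,\theta_a)\simeq(A,\tau)$ as algebras with involution; (iii) $g\varepsilon(b)=\tau(h)h$ for some $b\in F^\times$ and $h\in A^\times$.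
   Context: Condition (I1): with $K=L^\tau$, $\dim_K E^\sigma=n$ if $\sigma|_L\neq\mathrm{id}_L$, and $\dim_K E^\sigma=\lfloor (n+1)/2\rfloor$ if $\sigma|_L=\mathrm{id}_L$. When $\tau$ is of the first kind ($\tau|_L=\mathrm{id}_L$), $L$ is assumed to have characteristic $\neq 2$. An embedding of algebras with involution is an injective homomorphism $\iota$ with $\iota\circ\sigma=\tau\circ\iota$. *)

theory Defs
  imports "HOL-Computational_Algebra.Computational_Algebra"
begin

text \<open>An algebra over a field \<open>L\<close> (the type \<open>'l\<close>) is a nonzero unital ring (a type \<open>'a::ring_1\<close>)
  with a scalar multiplication; \<open>L\<close> sits in it as the scalar multiples of \<open>1\<close>.\<close>

locale unital_algebra = vector_space scale
  for scale :: "'l::field \<Rightarrow> 'a::ring_1 \<Rightarrow> 'a" +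
  assumes mult_scale_left: "scale c x * y = scale c (x * y)"
    and mult_scale_right: "x * scale c y = scale c (x * y)"

definition two_sided_ideal :: "'a::ring_1 set \<Rightarrow> bool" where
  "two_sided_ideal I \<longleftrightarrow>
     0 \<in> I \<and> (\<forall>x\<in>I. \<forall>y\<in>I. x + y \<in> I) \<and> (\<forall>x\<in>I. \<forall>r. r * x \<in> I \<and> x * r \<in> I)"

locale central_simple_algebra = unital_algebra scale
  for scale :: "'l::field \<Rightarrow> 'a::ring_1 \<Rightarrow> 'a" +
  assumes finite_dimensional: "\<exists>B. finite B \<and> span B = UNIV"
    and central: "{z. \<forall>x. z * x = x * z} = range (\<lambda>c. scale c 1)"
    and simple: "two_sided_ideal (I :: 'a set) \<Longrightarrow> I = {0} \<or> I = UNIV"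

text \<open>For an idempotent \<open>e\<close> of a commutative \<open>L\<close>-algebra \<open>E\<close>, the ideal \<open>eE\<close> is an \<open>L\<close>-algebra with
  unit \<open>e\<close> and structure map \<open>c \<mapsto> ce\<close>. The predicate says that \<open>eE\<close> is a separable algebraic field
  extension of \<open>L\<close>.\<close>

definition separable_field_component ::
    "('l::field \<Rightarrow> 'e::comm_ring_1 \<Rightarrow> 'e) \<Rightarrow> 'e \<Rightarrow> bool" where
  "separable_field_component scale e \<longleftrightarrow>
     e * e = e \<and> e \<noteq> 0 \<and>
     (\<forall>x \<in> range ((*) e). x \<noteq> 0 \<longrightarrow> (\<exists>y \<in> range ((*) e). x * y = e)) \<and>
     (\<forall>x \<in> range ((*) e). \<exists>p :: 'l poly.
        irreducible p \<and> coprime p (pderiv p) \<and> poly (map_poly (\<lambda>c. scale c e) p) x = 0)"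

text \<open>A commutative \<open>L\<close>-algebra is etale if it is a product of finitely many finite separable field
  extensions of \<open>L\<close>. The product decomposition is given by the orthogonal idempotents \<open>e \<in> U\<close>, the
  factors being the ideals \<open>eE\<close>.\<close>

locale etale_algebra = unital_algebra scale
  for scale :: "'l::field \<Rightarrow> 'e::comm_ring_1 \<Rightarrow> 'e" +
  assumes finite_dimensional: "\<exists>B. finite B \<and> span B = UNIV"
    and product_of_fields: "\<exists>U. finite U \<and> (\<forall>e\<in>U. separable_field_component scale e) \<and>
      (\<forall>e\<in>U. \<forall>f\<in>U. e \<noteq> f \<longrightarrow> e * f = 0) \<and> \<Sum>U = 1"

text \<open>\<open>V\<close> is a vector space of dimension \<open>d\<close> over the subfield \<open>K\<close> of \<open>L\<close>. (The library's \<open>dim\<close> takes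
  the whole scalar type as its field of scalars.)\<close>

definition has_dim_over :: "('l::field \<Rightarrow> 'v::ab_group_add \<Rightarrow> 'v) \<Rightarrow> 'l set \<Rightarrow> 'v set \<Rightarrow> nat \<Rightarrow> bool" where
  "has_dim_over scale K V d \<longleftrightarrow>
     (\<exists>B. finite B \<and> card B = d \<and>
        V = {\<Sum>b\<in>B. scale (c b) b | c. \<forall>b\<in>B. c b \<in> K} \<and>
        (\<forall>c. (\<forall>b\<in>B. c b \<in> K) \<and> (\<Sum>b\<in>B. scale (c b) b) = 0 \<longrightarrow> (\<forall>b\<in>B. c b = 0)))"

text \<open>As usual for algebras, the identity of a commutative ring counts as an involution.\<close>

definition ring_involution :: "('a::ring_1 \<Rightarrow> 'a) \<Rightarrow> bool" where
  "ring_involution \<tau> \<longleftrightarrow>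
     (\<forall>x y. \<tau> (x + y) = \<tau> x + \<tau> y) \<and> (\<forall>x y. \<tau> (x * y) = \<tau> y * \<tau> x) \<and> (\<forall>x. \<tau> (\<tau> x) = x)"

definition ring_automorphism :: "('a::ring_1 \<Rightarrow> 'a) \<Rightarrow> bool" where
  "ring_automorphism \<sigma> \<longleftrightarrow>
     bij \<sigma> \<and> (\<forall>x y. \<sigma> (x + y) = \<sigma> x + \<sigma> y) \<and> (\<forall>x y. \<sigma> (x * y) = \<sigma> x * \<sigma> y) \<and> \<sigma> 1 = 1"

definition fixed_set :: "('a \<Rightarrow> 'a) \<Rightarrow> 'a set" where
  "fixed_set f = {x. f x = x}"

text \<open>The group of units of a subring \<open>S\<close>; \<open>A\<close>'s own unit group is \<open>units_of_subring UNIV\<close>.\<close>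

definition units_of_subring :: "'a::ring_1 set \<Rightarrow> 'a set" where
  "units_of_subring S = {x \<in> S. \<exists>y\<in>S. x * y = 1 \<and> y * x = 1}"

definition unit_inverse :: "'a::ring_1 \<Rightarrow> 'a" where
  "unit_inverse x = (THE y. x * y = 1 \<and> y * x = 1)"

definition Int_conj :: "'a::ring_1 \<Rightarrow> 'a \<Rightarrow> 'a" where
  "Int_conj y z = y * z * unit_inverse y"

definition algebra_hom ::
    "('l::field \<Rightarrow> 'a::ring_1 \<Rightarrow> 'a) \<Rightarrow> ('l \<Rightarrow> 'b::ring_1 \<Rightarrow> 'b) \<Rightarrow> ('a \<Rightarrow> 'b) \<Rightarrow> bool" where
  "algebra_hom sA sB f \<longleftrightarrow>
     Vector_Spaces.linear sA sB f \<and> (\<forall>x y. f (x * y) = f x * f y) \<and> f 1 = 1"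

definition algebra_embedding ::
    "('l::field \<Rightarrow> 'a::ring_1 \<Rightarrow> 'a) \<Rightarrow> ('l \<Rightarrow> 'b::ring_1 \<Rightarrow> 'b) \<Rightarrow> ('a \<Rightarrow> 'b) \<Rightarrow> bool" where
  "algebra_embedding sA sB f \<longleftrightarrow> algebra_hom sA sB f \<and> inj f"

definition embedding_with_involution ::
    "('l::field \<Rightarrow> 'a::ring_1 \<Rightarrow> 'a) \<Rightarrow> ('a \<Rightarrow> 'a) \<Rightarrow> ('l \<Rightarrow> 'b::ring_1 \<Rightarrow> 'b) \<Rightarrow> ('b \<Rightarrow> 'b) \<Rightarrow>
     ('a \<Rightarrow> 'b) \<Rightarrow> bool" where
  "embedding_with_involution sA \<sigma> sB \<tau> f \<longleftrightarrow> algebra_embedding sA sB f \<and> f \<circ> \<sigma> = \<tau> \<circ> f"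

definition isomorphic_with_involution ::
    "('l::field \<Rightarrow> 'a::ring_1 \<Rightarrow> 'a) \<Rightarrow> ('a \<Rightarrow> 'a) \<Rightarrow> ('l \<Rightarrow> 'b::ring_1 \<Rightarrow> 'b) \<Rightarrow> ('b \<Rightarrow> 'b) \<Rightarrow> bool" where
  "isomorphic_with_involution sA \<sigma> sB \<tau> \<longleftrightarrow>
     (\<exists>f. algebra_hom sA sB f \<and> bij f \<and> f \<circ> \<sigma> = \<tau> \<circ> f)"

end

theory Submission
  imports Defs
begin

text \<open>Given (iii), conjugation by \<open>h\<close> is an isomorphism from \<open>\<theta>\<^sub>b\<close> to \<open>\<tau>\<close>; given (ii), composing the
  isomorphism with \<open>\<epsilon>\<close> yields \<open>\<iota>\<close>, because \<open>\<theta>\<^sub>a \<circ> \<epsilon> = \<epsilon> \<circ> \<sigma>\<close>. From (i) to (iii) one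
  writes \<open>\<iota> = Int(h) \<circ> \<epsilon>\<close>: then \<open>g\<inverse> \<tau>(h) h\<close> centralizes \<open>\<epsilon>(E)\<close>, hence equals \<open>\<epsilon>(b)\<close>, and \<open>b\<close> is fixed
  by \<open>\<sigma>\<close> because \<open>\<tau>(h) h\<close> is fixed by \<open>\<tau>\<close>.

  The two facts used here, conjugacy of \<open>\<iota>\<close> and \<open>\<epsilon>\<close> and \<open>\<epsilon>(E)\<close> being its own centralizer, come from
  the structure of \<open>A\<close> as an \<open>E\<close>-\<open>E\<close>-bimodule through \<open>\<iota>\<close> and \<open>\<epsilon>\<close>. As \<open>E\<close> is separable, the algebra
  \<open>E \<otimes> E\<close> is commutative semisimple; as \<open>A\<close> is central simple, it acts faithfully. So \<open>A\<close> has a vector with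
  zero annihilator, and is free of rank one since both dimensions are \<open>n\<^sup>2\<close>. Averaging a generator
  over the separability element yields the intertwiner \<open>h\<close>.\<close>

subsection \<open>Separability elements\<close>

text \<open>A list of pairs stands for an element of the tensor square of \<open>E\<close> over \<open>L\<close>, which is observed only
  through balanced biadditive maps.\<close>

definition balanced :: "('l \<Rightarrow> 'e \<Rightarrow> 'e) \<Rightarrow> ('e::comm_ring_1 \<Rightarrow> 'e \<Rightarrow> 'w::ab_group_add) \<Rightarrow> bool" where
  "balanced s \<beta> \<longleftrightarrow>
     (\<forall>x y z. \<beta> (x + y) z = \<beta> x z + \<beta> y z) \<and> (\<forall>x y z. \<beta> x (y + z) = \<beta> x y + \<beta> x z) \<and>
     (\<forall>c x y. \<beta> (s c x) y = \<beta> x (s c y))"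

definition tensor_sum :: "('e \<Rightarrow> 'e \<Rightarrow> 'w::ab_group_add) \<Rightarrow> ('e \<times> 'e) list \<Rightarrow> 'w" where
  "tensor_sum \<beta> ps = (\<Sum>(x, y)\<leftarrow>ps. \<beta> x y)"

text \<open>The product of the ring E tensor E, computed on formal sums of pure tensors.\<close>

fun tensor_mult :: "('e::comm_ring_1 \<times> 'e) list \<Rightarrow> ('e \<times> 'e) list \<Rightarrow> ('e \<times> 'e) list" where
  "tensor_mult [] qs = []"
| "tensor_mult ((a, b) # ps) qs = map (\<lambda>(c, d). (a * c, b * d)) qs @ tensor_mult ps qs"

text \<open>As an element of E tensor E, \<open>ps\<close> is killed by x tensor 1 - 1 tensor x, as
  far as the maps in \<open>M\<close> can see. The argument \<open>M\<close> also fixes the target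
  group of the test maps, over whose type a definition cannot quantify.\<close>

definition commutes_with ::
    "('e::comm_ring_1 \<Rightarrow> 'e \<Rightarrow> 'w::ab_group_add) set \<Rightarrow> ('e \<times> 'e) list \<Rightarrow> 'e \<Rightarrow> bool" where
  "commutes_with M ps x \<longleftrightarrow>
     (\<forall>\<beta>\<in>M. tensor_sum (\<lambda>a b. \<beta> (x * a) b) ps = tensor_sum (\<lambda>a b. \<beta> a (x * b)) ps)"

section \<open>Balanced maps evaluated on formal tensors\<close>

lemma balanced_zero:
  assumes "balanced s \<beta>" shows "\<beta> 0 y = 0" "\<beta> y 0 = 0"
proof -
  have "\<beta> (0 + 0) y = \<beta> 0 y + \<beta> 0 y" "\<beta> y (0 + 0) = \<beta> y 0 + \<beta> y 0"
    using assms unfolding balanced_def by blast+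
  then show "\<beta> 0 y = 0" "\<beta> y 0 = 0"
    by simp_all
qed

lemma tensor_sum_simps [simp]:
  "tensor_sum \<beta> [] = 0"
  "tensor_sum \<beta> ((x, y) # ps) = \<beta> x y + tensor_sum \<beta> ps"
  "tensor_sum \<beta> (ps @ qs) = tensor_sum \<beta> ps + tensor_sum \<beta> qs"
  by (simp_all add: tensor_sum_def)

lemma commutes_withD:
  assumes "commutes_with M ps x" "\<beta> \<in> M"
  shows "tensor_sum (\<lambda>a b. \<beta> (x * a) b) ps = tensor_sum (\<lambda>a b. \<beta> a (x * b)) ps"
  using assms unfolding commutes_with_def by blast

lemma tensor_sum_map:
  "tensor_sum \<beta> (map (\<lambda>(x, y). (f x y, h x y)) ps) = tensor_sum (\<lambda>x y. \<beta> (f x y) (h x y)) ps"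
  by (induction ps) auto

lemma tensor_sum_mult:
  "tensor_sum \<beta> (tensor_mult ps qs) =
     tensor_sum (\<lambda>a b. tensor_sum (\<lambda>c d. \<beta> (a * c) (b * d)) qs) ps"
  by (induction ps) (auto simp: tensor_sum_map)

lemma tensor_sum_add: "tensor_sum (\<lambda>a b. f a b + h a b) ps = tensor_sum f ps + tensor_sum h ps"
  by (induction ps) (auto simp: algebra_simps)

lemma tensor_sum_hom:
  assumes "\<And>x y. f (x + y) = f x + f y"
  shows "f (tensor_sum \<beta> ps) = tensor_sum (\<lambda>a b. f (\<beta> a b)) ps"
proof -
  have "f 0 = 0"
    using assms[of 0 0] by simp
  then show ?thesis
    by (induction ps) (auto simp: assms)
qed

lemma tensor_sum_cong:
  assumes "\<And>x y. f x y = h x y" shows "tensor_sum f ps = tensor_sum h ps"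
proof -
  have "f = h"
    using assms by blast
  then show ?thesis
    by simp
qed

lemma tensor_sum_mult_product:
  "tensor_sum (*) (tensor_mult ps qs) = tensor_sum (*) ps * tensor_sum (*) qs"
proof -
  have "tensor_sum (*) (map (\<lambda>(c, d). (a * c, b * d)) qs) = a * b * tensor_sum (*) qs" for a b
    by (induction qs) (auto simp: algebra_simps)
  then show ?thesis
    by (induction ps) (auto simp: algebra_simps)
qed

section \<open>Inverses in finite-dimensional algebras\<close>

lemma (in unital_algebra) finite_basis_exists:
  assumes "\<exists>B. finite B \<and> span B = UNIV"
  obtains B where "finite_dimensional_vector_space scale B" "finite B" "independent B"
    "span B = UNIV" "card B = dim UNIV"
proof -
  obtain C where C: "finite C" "span C = UNIV"
    using assms by blast
  obtain B where B: "independent B" "UNIV \<subseteq> span B" "card B = dim (UNIV :: 'a set)"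
    by (metis basis_exists)
  have "finite B"
    using independent_span_bound[OF C(1) B(1)] C(2) by simp
  moreover from this have "finite_dimensional_vector_space scale B"
    using B by unfold_locales auto
  ultimately show ?thesis
    using that B by blast
qed

lemma (in unital_algebra) linear_mult_right: "Vector_Spaces.linear scale scale (\<lambda>x. x * a)"
  by unfold_locales (simp_all add: distrib_right mult_scale_left)

lemma (in unital_algebra) linear_mult_left: "Vector_Spaces.linear scale scale (\<lambda>x. a * x)"
  by unfold_locales (simp_all add: distrib_left mult_scale_right)

text \<open>Right multiplication by \<open>h\<close> is surjective because y = (y z) h, hence
  injective by finite dimension, and it sends both \<open>h * z\<close> and 1 to
  \<open>h\<close>.\<close>

lemma (in unital_algebra) left_inverse_imp_right_inverse:
  fixes z h :: 'a
  assumes fin: "\<exists>B. finite B \<and> span B = UNIV" and "z * h = 1"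
  shows "h * z = 1"
proof -
  obtain B where "finite_dimensional_vector_space scale B"
    by (rule finite_basis_exists[OF fin])
  then interpret fd: finite_dimensional_vector_space scale B .
  have "y = (y * z) * h" for y
    using assms(2) by (simp add: mult.assoc)
  then have "surj (\<lambda>x. x * h)"
    by (rule surjI[OF sym])
  then have "inj (\<lambda>x. x * h)"
    using fd.linear_surj_imp_inj[OF linear_mult_right] by blast
  moreover have "(h * z) * h = 1 * h"
    using assms(2) by (simp add: mult.assoc)
  ultimately show ?thesis
    by (simp add: inj_def)
qed

lemma (in unital_algebra) injective_mult_imp_unit:
  fixes x :: 'a
  assumes fin: "\<exists>B. finite B \<and> span B = UNIV" and "\<And>y. x * y = 0 \<Longrightarrow> y = 0"
  shows "\<exists>z. x * z = 1"
proof -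
  obtain B where "finite_dimensional_vector_space scale B"
    by (rule finite_basis_exists[OF fin])
  then interpret fd: finite_dimensional_vector_space scale B .
  have "inj (\<lambda>y. x * y)"
  proof (rule injI)
    fix y z assume "x * y = x * z"
    then have "x * (y - z) = 0"
      by (simp add: right_diff_distrib)
    then show "y = z"
      using assms(2) by fastforce
  qed
  then have "surj (\<lambda>y. x * y)"
    using fd.linear_inj_imp_surj[OF linear_mult_left] by blast
  then show ?thesis
    by (metis surjD)
qed

section \<open>Polynomial values in a component and separability of E over L\<close>

locale commutative_algebra = unital_algebra scale
  for scale :: "'l::field \<Rightarrow> 'e::comm_ring_1 \<Rightarrow> 'e"
begin

text \<open>Evaluation in \<open>eE\<close>; it is multiplicative but maps \<open>1\<close> to \<open>e\<close>.\<close>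

definition eval_at :: "'e \<Rightarrow> 'e \<Rightarrow> 'l poly \<Rightarrow> 'e" where
  "eval_at e x p = poly (map_poly (\<lambda>c. scale c e) p) x"

lemma eval_at_0 [simp]: "eval_at e x 0 = 0"
  by (simp add: eval_at_def)

lemma eval_at_pCons [simp]: "eval_at e x (pCons c p) = scale c e + x * eval_at e x p"
  by (simp add: eval_at_def map_poly_pCons)

lemma eval_at_add [simp]: "eval_at e x (p + q) = eval_at e x p + eval_at e x q"
  by (induction p q rule: poly_induct2) (auto simp: algebra_simps)

lemma eval_at_smult [simp]: "eval_at e x (smult c p) = scale c (eval_at e x p)"
  by (induction p) (auto simp: algebra_simps mult_scale_right)

text \<open>As \<open>e\<close> is idempotent, it acts as the identity on every value
  \<open>eval_at e x q\<close>, so a constant c e multiplies values in the same way as the scalar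
  c.\<close>

lemma eval_at_mult:
  assumes "e * e = e" shows "eval_at e x (p * q) = eval_at e x p * eval_at e x q"
proof -
  have e: "e * eval_at e x q = eval_at e x q" for q
  proof (induction q)
    case (pCons c q)
    have "e * (scale c e + x * eval_at e x q) = scale c (e * e) + x * (e * eval_at e x q)"
      by (simp add: algebra_simps mult_scale_right)
    then show ?case
      using assms pCons by simp
  qed simp
  show ?thesis
  proof (induction p)
    case (pCons c p)
    have "scale c (eval_at e x q) = scale c e * eval_at e x q"
      by (simp add: mult_scale_left e)
    then show ?case
      using pCons by (simp add: algebra_simps)
  qed simp
qed

text \<open>A generator of the kernel of the evaluation would divide both \<open>p\<close> and \<open>p'\<close>.\<close>

lemma eval_at_pderiv_nonzero:
  assumes e: "e * e = e" "e \<noteq> 0" and p: "p \<noteq> 0" "coprime p (pderiv p)" "eval_at e x p = 0"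
  shows "eval_at e x (pderiv p) \<noteq> 0"
proof
  assume d: "eval_at e x (pderiv p) = 0"
  define P where "P q \<longleftrightarrow> q \<noteq> 0 \<and> eval_at e x q = 0" for q
  \<comment> \<open>A nonzero polynomial of least degree that vanishes at \<open>x\<close> generates
    the kernel of evaluation, by division with remainder.\<close>
  obtain m where m: "P m" "\<And>q. P q \<Longrightarrow> degree m \<le> degree q"
    using p(1,3) ex_has_least_nat[of P p degree] unfolding P_def by blast
  have dvd: "m dvd q" if q: "eval_at e x q = 0" for q
  proof (rule ccontr)
    assume "\<not> m dvd q"
    then have ne: "q mod m \<noteq> 0"
      by (simp add: mod_eq_0_iff_dvd)
    have "eval_at e x (m * (q div m) + q mod m) = 0"
      using q by (simp only: mult_div_mod_eq)
    then have "eval_at e x m * eval_at e x (q div m) + eval_at e x (q mod m) = 0"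
      by (simp only: eval_at_add eval_at_mult[OF e(1)])
    then have "eval_at e x (q mod m) = 0"
      using m(1) by (simp add: P_def)
    then have "degree m \<le> degree (q mod m)"
      using m(2) ne by (simp add: P_def)
    moreover have "degree (q mod m) < degree m"
      using degree_mod_less[of m q] m(1) ne by (auto simp: P_def)
    ultimately show False
      by simp
  qed
  have "m dvd 1"
    using coprime_common_divisor[OF p(2) dvd[OF p(3)] dvd[OF d]] .
  then obtain k where "1 = m * k"
    by (auto elim: dvdE)
  then have "eval_at e x 1 = eval_at e x m * eval_at e x k"
    by (metis eval_at_mult[OF e(1)])
  then have "eval_at e x 1 = 0"
    using m(1) by (simp add: P_def)
  then show False
    using e(2) by (simp add: one_pCons)
qed

text \<open>Precomposition with multiplication by a tensor b. It allows a relation in E tensor E to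
  be multiplied by any pure tensor.\<close>

lemma balanced_mult_left:
  assumes "balanced scale \<beta>" shows "balanced scale (\<lambda>x y. \<beta> (a * x) (b * y))"
proof -
  have "a * scale c x = scale c (a * x)" for a c x
    by (rule mult_scale_right)
  then show ?thesis
    using assms by (simp add: balanced_def distrib_left)
qed

text \<open>The pairs are those of the difference quotient \<open>(p(X) - p(Y)) / (X - Y)\<close>, whose value on
  the diagonal is \<open>p'\<close>.\<close>

lemma difference_quotient:
  assumes e: "e * e = e" "e * x = x"
  shows "\<exists>ps. tensor_sum (*) ps = eval_at e x (pderiv p) \<and>
     (\<forall>\<beta> :: 'e \<Rightarrow> 'e \<Rightarrow> 'w::ab_group_add. balanced scale \<beta> \<longrightarrow>
        tensor_sum (\<lambda>a b. \<beta> (x * a) b) ps + \<beta> e (eval_at e x p) =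
        tensor_sum (\<lambda>a b. \<beta> a (x * b)) ps + \<beta> (eval_at e x p) e)"
proof (induction p)
  case 0
  show ?case
    by (auto intro!: exI[of _ "[]"] simp: balanced_zero)
next
  case (pCons c q)
  obtain ps where ps: "tensor_sum (*) ps = eval_at e x (pderiv q)"
    "\<And>\<beta> :: 'e \<Rightarrow> 'e \<Rightarrow> 'w. balanced scale \<beta> \<Longrightarrow>
        tensor_sum (\<lambda>a b. \<beta> (x * a) b) ps + \<beta> e (eval_at e x q) =
        tensor_sum (\<lambda>a b. \<beta> a (x * b)) ps + \<beta> (eval_at e x q) e"
    using pCons.IH by blast
  \<comment> \<open>For p = c + X q, the quotient (p(X) - p(Y)) / (X - Y) equals q(X) + Y (q(X) -
    q(Y)) / (X - Y).\<close>
  define qs where "qs = (eval_at e x q, e) # map (\<lambda>(a, b). (a, x * b)) ps"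
  have eq: "eval_at e x q * e = eval_at e x q"
    using eval_at_mult[OF e(1), of x q 1] by (simp add: one_pCons)
  have "tensor_sum (*) (map (\<lambda>(a, b). (a, x * b)) ps) = x * tensor_sum (*) ps"
    by (induction ps) (auto simp: algebra_simps)
  then have 1: "tensor_sum (*) qs = eval_at e x (pderiv (pCons c q))"
    by (simp add: qs_def pderiv_pCons ps(1) eq)
  have 2: "tensor_sum (\<lambda>a b. \<beta> (x * a) b) qs + \<beta> e (eval_at e x (pCons c q)) =
        tensor_sum (\<lambda>a b. \<beta> a (x * b)) qs + \<beta> (eval_at e x (pCons c q)) e"
    if \<beta>: "balanced scale \<beta>" for \<beta> :: "'e \<Rightarrow> 'e \<Rightarrow> 'w"
  proof -
    have "balanced scale (\<lambda>a b. \<beta> a (x * b))"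
      using balanced_mult_left[OF \<beta>, of 1 x] by simp
    note * = ps(2)[OF this]
    have "\<beta> (scale c e) e = \<beta> e (scale c e)"
      "\<And>x y z. \<beta> (x + y) z = \<beta> x z + \<beta> y z" "\<And>x y z. \<beta> x (y + z) = \<beta> x y + \<beta> x z"
      using \<beta> by (auto simp: balanced_def)
    then show ?thesis
      using * e(2) by (simp add: qs_def tensor_sum_map algebra_simps)
  qed
  show ?case
    using 1 2 by blast
qed

text \<open>The difference quotient of a separable polynomial \<open>p\<close> vanishing at
  \<open>x\<close> commutes with \<open>x\<close>, and its diagonal value p'(x) is nonzero, hence
  invertible in the field eE. Dividing by p'(x) and completing outside eE gives diagonal value
  1.\<close>

lemma component_separable:
  assumes comp: "separable_field_component scale e" and x: "x \<in> range ((*) e)"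
  shows "\<exists>ps. tensor_sum (*) ps = 1 \<and>
     commutes_with (Collect (balanced scale) :: ('e \<Rightarrow> 'e \<Rightarrow> 'w::ab_group_add) set) ps x"
proof -
  have e: "e * e = e" "e \<noteq> 0"
    using comp by (auto simp: separable_field_component_def)
  have ex: "e * x = x"
    using x e(1) by (auto simp flip: mult.assoc)
  obtain p :: "'l poly" where p: "irreducible p" "coprime p (pderiv p)" "eval_at e x p = 0"
    using comp x unfolding separable_field_component_def eval_at_def by metis
  have "p \<noteq> 0"
    using p(1) by auto
  have "eval_at e x (pderiv p) \<noteq> 0"
    by (rule eval_at_pderiv_nonzero) (use e p \<open>p \<noteq> 0\<close> in auto)
  moreover have "eval_at e x (pderiv p) = e * eval_at e x (pderiv p)"
    using eval_at_mult[OF e(1), of x 1 "pderiv p"] by (simp add: one_pCons)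
  then have "eval_at e x (pderiv p) \<in> range ((*) e)"
    by (metis rangeI)
  ultimately obtain d where d: "eval_at e x (pderiv p) * d = e"
    using comp unfolding separable_field_component_def by metis
  obtain ps where ps: "tensor_sum (*) ps = eval_at e x (pderiv p)"
    "\<And>\<beta> :: 'e \<Rightarrow> 'e \<Rightarrow> 'w. balanced scale \<beta> \<Longrightarrow>
        tensor_sum (\<lambda>a b. \<beta> (x * a) b) ps + \<beta> e (eval_at e x p) =
        tensor_sum (\<lambda>a b. \<beta> a (x * b)) ps + \<beta> (eval_at e x p) e"
    using difference_quotient[OF e(1) ex, of p] by blast
  \<comment> \<open>The factor \<open>d\<close>, inverse to p'(x) in eE, makes the diagonal value
    \<open>e\<close>. The extra tensor raises it to 1 and does not disturb commutation with
    \<open>x\<close>, since x (1 - e) = 0.\<close>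
  define qs where "qs = (1 - e, 1 - e) # map (\<lambda>(a, b). (a, d * b)) ps"
  have "tensor_sum (*) (map (\<lambda>(a, b). (a, d * b)) ps) = d * tensor_sum (*) ps"
    by (induction ps) (auto simp: algebra_simps)
  then have "tensor_sum (*) qs = 1"
    using d e(1) by (simp add: qs_def ps(1) algebra_simps)
  moreover have "tensor_sum (\<lambda>a b. \<beta> (x * a) b) qs = tensor_sum (\<lambda>a b. \<beta> a (x * b)) qs"
    if \<beta>: "balanced scale \<beta>" for \<beta> :: "'e \<Rightarrow> 'e \<Rightarrow> 'w"
  proof -
    note z = balanced_zero[OF \<beta>]
    have "x * (1 - e) = 0"
      using ex by (simp add: algebra_simps)
    moreover have "balanced scale (\<lambda>a b. \<beta> a (d * b))"
      using balanced_mult_left[OF \<beta>, of 1 d] by simp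
    from ps(2)[OF this]
    have "tensor_sum (\<lambda>a b. \<beta> (x * a) (d * b)) ps = tensor_sum (\<lambda>a b. \<beta> a (d * (x * b))) ps"
      by (simp add: p(3) z)
    ultimately show ?thesis
      by (simp add: qs_def z tensor_sum_map algebra_simps)
  qed
  ultimately show ?thesis
    unfolding commutes_with_def by blast
qed

text \<open>Elements that work for one \<open>x\<close> at a time are multiplied in E tensor E: the
  diagonal value is multiplicative, and a multiple of something killed by x tensor 1 - 1 tensor x is
  again killed.\<close>

lemma finite_set_separable:
  assumes "finite G" and "\<And>x. x \<in> G \<Longrightarrow> \<exists>ps. tensor_sum (*) ps = 1 \<and>
     commutes_with (Collect (balanced scale) :: ('e \<Rightarrow> 'e \<Rightarrow> 'w::ab_group_add) set) ps x"
  shows "\<exists>ps. tensor_sum (*) ps = 1 \<and>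
     (\<forall>x\<in>G. commutes_with (Collect (balanced scale) :: ('e \<Rightarrow> 'e \<Rightarrow> 'w) set) ps x)"
  using assms
proof (induction G rule: finite_induct)
  case empty
  show ?case
    by (auto intro!: exI[of _ "[(1, 1)]"])
next
  case (insert g G)
  let ?M = "Collect (balanced scale) :: ('e \<Rightarrow> 'e \<Rightarrow> 'w) set"
  obtain ps where ps: "tensor_sum (*) ps = 1" "\<And>x. x \<in> G \<Longrightarrow> commutes_with ?M ps x"
    using insert by blast
  obtain qs where qs: "tensor_sum (*) qs = 1" "commutes_with ?M qs g"
    using insert by blast
  have 1: "tensor_sum (*) (tensor_mult ps qs) = 1"
    by (simp add: tensor_sum_mult_product ps qs)
  have 2: "commutes_with ?M (tensor_mult ps qs) g"
    unfolding commutes_with_def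
  proof
    fix \<beta> :: "'e \<Rightarrow> 'e \<Rightarrow> 'w" assume \<beta>: "\<beta> \<in> ?M"
    have "balanced scale (\<lambda>c d. \<beta> (a * c) (b * d))" for a b
      using \<beta> by (simp add: balanced_mult_left)
    then have "tensor_sum (\<lambda>c d. \<beta> (a * (g * c)) (b * d)) qs =
        tensor_sum (\<lambda>c d. \<beta> (a * c) (b * (g * d))) qs" for a b
      using commutes_withD[OF qs(2), of "\<lambda>c d. \<beta> (a * c) (b * d)"] by simp
    then show "tensor_sum (\<lambda>a b. \<beta> (g * a) b) (tensor_mult ps qs) =
        tensor_sum (\<lambda>a b. \<beta> a (g * b)) (tensor_mult ps qs)"
      by (simp add: tensor_sum_mult mult.left_commute)
  qed
  have 3: "commutes_with ?M (tensor_mult ps qs) x" if "x \<in> G" for x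
    unfolding commutes_with_def
  proof
    fix \<beta> :: "'e \<Rightarrow> 'e \<Rightarrow> 'w" assume \<beta>: "\<beta> \<in> ?M"
    have "balanced scale (\<lambda>a b. tensor_sum (\<lambda>c d. \<beta> (a * c) (b * d)) qs)"
      using \<beta> by (simp add: balanced_def distrib_right mult_scale_left tensor_sum_add)
    then have "tensor_sum (\<lambda>a b. tensor_sum (\<lambda>c d. \<beta> (x * a * c) (b * d)) qs) ps =
        tensor_sum (\<lambda>a b. tensor_sum (\<lambda>c d. \<beta> (a * c) (x * b * d)) qs) ps"
      using commutes_withD[OF ps(2)[OF that],
          of "\<lambda>a b. tensor_sum (\<lambda>c d. \<beta> (a * c) (b * d)) qs"] by simp
    then show "tensor_sum (\<lambda>a b. \<beta> (x * a) b) (tensor_mult ps qs) =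
        tensor_sum (\<lambda>a b. \<beta> a (x * b)) (tensor_mult ps qs)"
      by (simp add: tensor_sum_mult mult.assoc)
  qed
  show ?case
    using 1 2 3 by blast
qed

text \<open>Reduces commutation with all of E to commutation with a spanning set.\<close>

lemma subspace_commutes_with:
  "subspace {x. commutes_with (Collect (balanced scale) :: ('e \<Rightarrow> 'e \<Rightarrow> 'w::ab_group_add) set) ps x}"
proof (rule subspaceI)
  let ?M = "Collect (balanced scale) :: ('e \<Rightarrow> 'e \<Rightarrow> 'w) set"
  show "0 \<in> {x. commutes_with ?M ps x}"
    by (auto simp: commutes_with_def balanced_zero intro!: tensor_sum_cong)
  show "x + y \<in> {x. commutes_with ?M ps x}"
    if "x \<in> {x. commutes_with ?M ps x}" "y \<in> {x. commutes_with ?M ps x}" for x y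
    unfolding mem_Collect_eq commutes_with_def
  proof
    fix \<beta> :: "'e \<Rightarrow> 'e \<Rightarrow> 'w" assume \<beta>: "\<beta> \<in> ?M"
    then have "\<And>x y z. \<beta> (x + y) z = \<beta> x z + \<beta> y z" "\<And>x y z. \<beta> x (y + z) = \<beta> x y + \<beta> x z"
      by (auto simp: balanced_def)
    then show "tensor_sum (\<lambda>a b. \<beta> ((x + y) * a) b) ps = tensor_sum (\<lambda>a b. \<beta> a ((x + y) * b)) ps"
      using that \<beta> by (simp add: distrib_right tensor_sum_add commutes_with_def)
  qed
  show "scale c x \<in> {x. commutes_with ?M ps x}" if x: "x \<in> {x. commutes_with ?M ps x}" for c x
    unfolding mem_Collect_eq commutes_with_def
  proof
    fix \<beta> :: "'e \<Rightarrow> 'e \<Rightarrow> 'w" assume \<beta>: "\<beta> \<in> ?M"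
    then have "balanced scale (\<lambda>a b. \<beta> (scale c a) b)"
      by (simp add: balanced_def scale_right_distrib mult.commute)
    then have "tensor_sum (\<lambda>a b. \<beta> (scale c (x * a)) b) ps =
        tensor_sum (\<lambda>a b. \<beta> (scale c a) (x * b)) ps"
      using x commutes_withD[of ?M ps x "\<lambda>a b. \<beta> (scale c a) b"] by simp
    then show "tensor_sum (\<lambda>a b. \<beta> (scale c x * a) b) ps =
        tensor_sum (\<lambda>a b. \<beta> a (scale c x * b)) ps"
      using \<beta> by (simp add: mult_scale_left balanced_def)
  qed
qed

end

lemma (in etale_algebra) separability_element:
  "\<exists>ps. tensor_sum (*) ps = 1 \<and>
     (\<forall>x. commutes_with (Collect (balanced scale) :: ('e \<Rightarrow> 'e \<Rightarrow> 'w::ab_group_add) set) ps x)"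
proof -
  let ?M = "Collect (balanced scale) :: ('e \<Rightarrow> 'e \<Rightarrow> 'w) set"
  interpret commutative_algebra scale
    by unfold_locales
  obtain B where B: "finite B" "span B = UNIV"
    using finite_dimensional by blast
  obtain U where U: "finite U" "\<And>e. e \<in> U \<Longrightarrow> separable_field_component scale e" "\<Sum>U = 1"
    using product_of_fields by blast
  \<comment> \<open>Each product lies in some component eE, where a single element can be treated,
    and the products span E because the idempotents in \<open>U\<close> sum to 1.\<close>
  define G where "G = (\<lambda>(e, b). e * b) ` (U \<times> B)"
  have "finite G"
    using B(1) U(1) by (simp add: G_def)
  moreover have "\<exists>ps. tensor_sum (*) ps = 1 \<and> commutes_with ?M ps x" if "x \<in> G" for x
  proof -
    obtain e b where "e \<in> U" "x = e * b"
      using \<open>x \<in> G\<close> by (auto simp: G_def)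
    then show ?thesis
      using component_separable[OF U(2), of e x] by blast
  qed
  ultimately obtain ps where ps: "tensor_sum (*) ps = 1" "\<And>x. x \<in> G \<Longrightarrow> commutes_with ?M ps x"
    using finite_set_separable[of G] by metis
  have "b \<in> span G" if "b \<in> B" for b
  proof -
    have "b = (\<Sum>e\<in>U. e * b)"
      by (simp add: U(3) flip: sum_distrib_right)
    also have "\<dots> \<in> span G"
      using that by (intro span_sum span_base) (auto simp: G_def)
    finally show ?thesis .
  qed
  then have "span B \<subseteq> span G"
    by (simp add: span_minimal subsetI)
  then have "span G = UNIV"
    using B(2) by auto
  moreover have "span G \<subseteq> {x. commutes_with ?M ps x}"
    using ps(2) by (intro span_minimal subspace_commutes_with) auto
  ultimately show ?thesis
    using ps(1) by blast
qed

subsection \<open>Two-sided multiplication operators\<close>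

text \<open>For subrings X and Y this is the ring of operators by which X tensor Y^op acts on the
  algebra. It serves both for the whole algebra on either side and for the images of two
  embeddings.\<close>

inductive_set sandwich_ops :: "'a::ring_1 set \<Rightarrow> 'a set \<Rightarrow> ('a \<Rightarrow> 'a) set"
  for X Y where
  zero: "(\<lambda>z. 0) \<in> sandwich_ops X Y"
| sandwich: "\<lbrakk>x \<in> X; y \<in> Y\<rbrakk> \<Longrightarrow> (\<lambda>z. x * z * y) \<in> sandwich_ops X Y"
| add: "\<lbrakk>\<phi> \<in> sandwich_ops X Y; \<psi> \<in> sandwich_ops X Y\<rbrakk> \<Longrightarrow> (\<lambda>z. \<phi> z + \<psi> z) \<in> sandwich_ops X Y"

section \<open>The ring of two-sided operators\<close>

lemma sandwich_ops_add: "\<phi> \<in> sandwich_ops X Y \<Longrightarrow> \<phi> (z + w) = \<phi> z + \<phi> w"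
  by (induction rule: sandwich_ops.induct) (auto simp: algebra_simps)

lemma sandwich_ops_zero: "\<phi> \<in> sandwich_ops X Y \<Longrightarrow> \<phi> 0 = 0"
  by (induction rule: sandwich_ops.induct) auto

lemma sandwich_ops_diff: "\<phi> \<in> sandwich_ops X Y \<Longrightarrow> \<phi> (z - w) = \<phi> z - \<phi> w"
  by (induction rule: sandwich_ops.induct) (auto simp: algebra_simps)

lemma sandwich_ops_mult_left:
  assumes "\<phi> \<in> sandwich_ops X Y" "x \<in> X" "\<And>a b. a \<in> X \<Longrightarrow> b \<in> X \<Longrightarrow> a * b \<in> X"
  shows "(\<lambda>z. x * \<phi> z) \<in> sandwich_ops X Y"
  using assms(1)
proof induction
  case (sandwich a b)
  then have "(\<lambda>z. (x * a) * z * b) \<in> sandwich_ops X Y"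
    using assms by (intro sandwich_ops.sandwich)
  then show ?case
    by (simp add: mult.assoc)
qed (auto simp: distrib_left intro: sandwich_ops.intros)

lemma sandwich_ops_mult_right:
  assumes "\<phi> \<in> sandwich_ops X Y" "y \<in> Y" "\<And>a b. a \<in> Y \<Longrightarrow> b \<in> Y \<Longrightarrow> a * b \<in> Y"
  shows "(\<lambda>z. \<phi> z * y) \<in> sandwich_ops X Y"
  using assms(1)
proof induction
  case (sandwich a b)
  then have "(\<lambda>z. a * z * (b * y)) \<in> sandwich_ops X Y"
    using assms by (intro sandwich_ops.sandwich)
  then show ?case
    by (simp add: mult.assoc)
qed (auto simp: distrib_right intro: sandwich_ops.intros)

lemma sandwich_ops_comp:
  assumes "\<phi> \<in> sandwich_ops X Y" "\<psi> \<in> sandwich_ops X Y"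
    and "\<And>a b. a \<in> X \<Longrightarrow> b \<in> X \<Longrightarrow> a * b \<in> X" "\<And>a b. a \<in> Y \<Longrightarrow> b \<in> Y \<Longrightarrow> a * b \<in> Y"
  shows "(\<lambda>z. \<phi> (\<psi> z)) \<in> sandwich_ops X Y"
  using assms(1)
proof induction
  case (sandwich x y)
  then show ?case
    using assms by (intro sandwich_ops_mult_left sandwich_ops_mult_right)
qed (auto intro: sandwich_ops.intros)

lemma sandwich_ops_commute:
  assumes "\<phi> \<in> sandwich_ops X Y" "\<psi> \<in> sandwich_ops X Y"
    and "\<And>a b. a \<in> X \<Longrightarrow> b \<in> X \<Longrightarrow> a * b = b * a" "\<And>a b. a \<in> Y \<Longrightarrow> b \<in> Y \<Longrightarrow> a * b = b * a"
  shows "\<phi> (\<psi> z) = \<psi> (\<phi> z)"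
  using assms(1)
proof induction
  case (sandwich x y)
  show ?case
    using assms(2)
  proof induction
    case (sandwich a b)
    have "x * (a * z * b) * y = (x * a) * z * (b * y)"
      by (simp add: mult.assoc)
    also have "\<dots> = (a * x) * z * (y * b)"
      using assms(3)[OF \<open>x \<in> X\<close> \<open>a \<in> X\<close>] assms(4)[OF \<open>b \<in> Y\<close> \<open>y \<in> Y\<close>] by simp
    finally show ?case
      by (simp add: mult.assoc)
  qed (auto simp: algebra_simps)
qed (auto simp: sandwich_ops_zero[OF assms(2)] sandwich_ops_add[OF assms(2)])

lemma sandwich_ops_tensor_sum:
  assumes "\<And>x y. F x y \<in> sandwich_ops X Y"
  shows "(\<lambda>z. tensor_sum (\<lambda>x y. F x y z) ps) \<in> sandwich_ops X Y"
  by (induction ps) (auto intro!: sandwich_ops.intros assms)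

lemma sandwich_ops_sum:
  assumes "\<And>i. i \<in> I \<Longrightarrow> F i \<in> sandwich_ops X Y"
  shows "(\<lambda>z. \<Sum>i\<in>I. F i z) \<in> sandwich_ops X Y"
  using assms
proof (induction I rule: infinite_finite_induct)
  case (insert i I)
  then have "(\<lambda>z. F i z + (\<Sum>i\<in>I. F i z)) \<in> sandwich_ops X Y"
    by (intro sandwich_ops.add) auto
  then show ?case
    using insert by simp
qed (auto intro: sandwich_ops.zero)

lemma sandwich_ops_UNIV_diff:
  assumes "\<phi> \<in> sandwich_ops UNIV UNIV" "\<psi> \<in> sandwich_ops UNIV UNIV"
  shows "(\<lambda>z. \<phi> z - \<psi> z) \<in> sandwich_ops UNIV UNIV"
  using sandwich_ops.add[OF assms(1) sandwich_ops_mult_left[OF assms(2), of "- 1"]] by simp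

text \<open>Jacobson density for the regular bimodule. If the operators vanishing on \<open>B\<close> also vanish at
  \<open>a\<close>, then the values at \<open>a\<close> of the operators dual to \<open>B\<close> are central, and \<open>a\<close> lies in the span of
  \<open>B\<close>.\<close>

lemma (in central_simple_algebra) dual_operator_exists:
  assumes "finite B" "independent B" "a \<in> B"
  shows "\<exists>\<phi>\<in>sandwich_ops UNIV UNIV. \<phi> a = 1 \<and> (\<forall>b\<in>B - {a}. \<phi> b = 0)"
  using assms
proof (induction B arbitrary: a rule: finite_induct)
  case (insert a B \<alpha>)
  let ?O = "sandwich_ops UNIV UNIV :: ('a \<Rightarrow> 'a) set"
  have indep: "independent B" "a \<notin> span B"
    using insert.prems(1) insert.hyps(2) by (auto simp: independent_insert)
  obtain D where D: "\<And>b. b \<in> B \<Longrightarrow> D b \<in> ?O" "\<And>b. b \<in> B \<Longrightarrow> D b b = 1"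
    "\<And>b c. b \<in> B \<Longrightarrow> c \<in> B \<Longrightarrow> c \<noteq> b \<Longrightarrow> D b c = 0"
  proof -
    have "\<forall>b\<in>B. \<exists>\<phi>. \<phi> \<in> ?O \<and> \<phi> b = 1 \<and> (\<forall>c\<in>B - {b}. \<phi> c = 0)"
      using insert.IH[OF indep(1)] by blast
    then obtain D where "\<forall>b\<in>B. D b \<in> ?O \<and> D b b = 1 \<and> (\<forall>c\<in>B - {b}. D b c = 0)"
      by metis
    then show ?thesis
      using that[of D] by blast
  qed
  \<comment> \<open>If this ideal is everything, some operator vanishing on \<open>B\<close> has
    value 1 at \<open>a\<close>. By simplicity only \<open>I = {0}\<close> has to be
    excluded.\<close>
  define I where "I = {\<phi> a | \<phi>. \<phi> \<in> ?O \<and> (\<forall>b\<in>B. \<phi> b = 0)}"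
  have I: "\<phi> a \<in> I" if "\<phi> \<in> ?O" "\<And>b. b \<in> B \<Longrightarrow> \<phi> b = 0" for \<phi>
    using that unfolding I_def by blast
  have "two_sided_ideal I"
    unfolding two_sided_ideal_def
  proof (intro conjI ballI allI)
    show "0 \<in> I"
      using I[OF sandwich_ops.zero] by simp
    fix x assume "x \<in> I"
    then obtain \<phi> where \<phi>: "\<phi> \<in> ?O" "\<forall>b\<in>B. \<phi> b = 0" "x = \<phi> a"
      unfolding I_def by blast
    show "r * x \<in> I" for r
      using I[OF sandwich_ops_mult_left[OF \<phi>(1), of r]] \<phi> by simp
    show "x * r \<in> I" for r
      using I[OF sandwich_ops_mult_right[OF \<phi>(1), of r]] \<phi> by simp
    fix y assume "y \<in> I"
    then obtain \<psi> where \<psi>: "\<psi> \<in> ?O" "\<forall>b\<in>B. \<psi> b = 0" "y = \<psi> a"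
      unfolding I_def by blast
    show "x + y \<in> I"
      using I[OF sandwich_ops.add[OF \<phi>(1) \<psi>(1)]] \<phi> \<psi> by simp
  qed
  moreover have "I \<noteq> {0}"
  proof
    assume I0: "I = {0}"
    have "\<exists>c. D b a = scale c 1" if b: "b \<in> B" for b
    proof -
      have "D b a * x = x * D b a" for x
      proof -
        \<comment> \<open>On \<open>B\<close> the operator \<open>D b\<close> takes only the central
          values 0 and 1, so its commutator with \<open>x\<close> vanishes there.\<close>
        have "(\<lambda>z. D b z * x - x * D b z) \<in> ?O"
          using D(1)[OF b] by (intro sandwich_ops_UNIV_diff sandwich_ops_mult_left sandwich_ops_mult_right) auto
        moreover have "D b c * x - x * D b c = 0" if "c \<in> B" for c
          using D(2)[OF b] D(3)[OF b that] by (cases "c = b") auto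
        ultimately have "D b a * x - x * D b a \<in> I"
          by (rule I)
        then show ?thesis
          using I0 by simp
      qed
      then show ?thesis
        using central by blast
    qed
    then obtain c where c: "\<And>b. b \<in> B \<Longrightarrow> D b a = scale (c b) 1"
      by metis
    have id: "(\<lambda>z. z) \<in> ?O"
      using sandwich_ops.sandwich[of 1 UNIV 1 UNIV] by simp
    \<comment> \<open>This operator also vanishes on \<open>B\<close>; its vanishing at
      \<open>a\<close> expresses \<open>a\<close> through the values \<open>D b a\<close>, which are
      scalars.\<close>
    have "(\<lambda>z. z - (\<Sum>b\<in>B. b * D b z)) \<in> ?O"
      using D(1) id by (intro sandwich_ops_UNIV_diff sandwich_ops_sum sandwich_ops_mult_left) auto
    moreover have "d - (\<Sum>b\<in>B. b * D b d) = 0" if "d \<in> B" for d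
    proof -
      have "(\<Sum>b\<in>B. b * D b d) = (\<Sum>b\<in>B. if b = d then d else 0)"
        using D(2,3) that by (intro sum.cong) auto
      then show ?thesis
        using that insert.hyps(1) by simp
    qed
    ultimately have "a - (\<Sum>b\<in>B. b * D b a) \<in> I"
      by (rule I)
    then have "a = (\<Sum>b\<in>B. b * D b a)"
      using I0 by simp
    also have "\<dots> = (\<Sum>b\<in>B. scale (c b) b)"
      by (intro sum.cong) (auto simp: c mult_scale_right)
    also have "\<dots> \<in> span B"
      by (intro span_sum span_scale span_base)
    finally show False
      using indep(2) by blast
  qed
  ultimately have "I = UNIV"
    using simple by blast
  then have "1 \<in> I"
    by simp
  then obtain \<phi> where \<phi>: "\<phi> \<in> ?O" "\<And>b. b \<in> B \<Longrightarrow> \<phi> b = 0" "\<phi> a = 1"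
    unfolding I_def by force
  show ?case
  proof (cases "\<alpha> = a")
    case True
    then show ?thesis
      using \<phi> by blast
  next
    case False
    then have \<alpha>: "\<alpha> \<in> B"
      using insert.prems by blast
    \<comment> \<open>\<open>D \<alpha>\<close> is already dual on \<open>B\<close>; subtracting a
      multiple of \<open>\<phi>\<close> removes its value at \<open>a\<close> without changing its
      values on \<open>B\<close>.\<close>
    have "(\<lambda>z. D \<alpha> z - D \<alpha> a * \<phi> z) \<in> ?O"
      using D(1)[OF \<alpha>] \<phi>(1) by (intro sandwich_ops_UNIV_diff sandwich_ops_mult_left) auto
    moreover have "D \<alpha> b - D \<alpha> a * \<phi> b = 0" if "b \<in> insert a B - {\<alpha>}" for b
    proof (cases "b = a")
      case False
      then show ?thesis
        using that D(3)[OF \<alpha>, of b] \<phi>(2)[of b] by simp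
    qed (simp add: \<phi>(3))
    moreover have "D \<alpha> \<alpha> - D \<alpha> a * \<phi> \<alpha> = 1"
      using D(2)[OF \<alpha>] \<phi>(2)[OF \<alpha>] by simp
    ultimately show ?thesis
      by (intro bexI[of _ "\<lambda>z. D \<alpha> z - D \<alpha> a * \<phi> z"] conjI ballI)
  qed
qed simp

text \<open>As \<open>J\<close> is a left ideal, x b y w = x b (y w) shows that each factor
  \<open>b\<close> may be replaced by \<open>\<phi> b\<close> for any two-sided operator
  \<open>\<phi>\<close>. An operator dual to \<open>B\<close> then isolates one term.\<close>

lemma (in central_simple_algebra) annihilated_left_ideal:
  assumes B: "finite B" "independent B" "b \<in> B"
    and J: "\<And>r w. w \<in> J \<Longrightarrow> r * w \<in> J"
    and zero: "\<And>w. w \<in> J \<Longrightarrow> (\<Sum>b\<in>B. b * w * t b) = 0"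
    and w: "w \<in> J"
  shows "w * t b = 0"
proof -
  obtain \<phi> where \<phi>: "\<phi> \<in> sandwich_ops UNIV UNIV" "\<phi> b = 1" "\<And>c. c \<in> B \<Longrightarrow> c \<noteq> b \<Longrightarrow> \<phi> c = 0"
    using dual_operator_exists[OF B] by auto
  have "(\<Sum>c\<in>B. \<phi> c * w * t c) = 0"
    using \<phi>(1)
  proof induction
    case (sandwich x y)
    have "(\<Sum>c\<in>B. x * c * y * w * t c) = x * (\<Sum>c\<in>B. c * (y * w) * t c)"
      by (simp add: sum_distrib_left mult.assoc)
    then show ?case
      using zero[OF J[OF w]] by simp
  qed (auto simp: algebra_simps sum.distrib)
  moreover have "(\<Sum>c\<in>B. \<phi> c * w * t c) = (\<Sum>c\<in>B. if c = b then w * t b else 0)"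
    using \<phi> by (intro sum.cong) auto
  ultimately show ?thesis
    using B by simp
qed

subsection \<open>Embeddings of an etale algebra of maximal dimension\<close>

text \<open>A becomes an E-E-bimodule, with \<open>\<iota>\<close> acting on the left and
  \<open>\<epsilon>\<close> on the right. The embeddings may coincide, in which case the
  intertwiners form the centralizer of the image.\<close>

locale etale_embedding_pair = A: central_simple_algebra sA + E: etale_algebra sE
  for sA :: "'l::field \<Rightarrow> 'a::ring_1 \<Rightarrow> 'a" and sE :: "'l \<Rightarrow> 'e::comm_ring_1 \<Rightarrow> 'e" +
  fixes \<iota> \<epsilon> :: "'e \<Rightarrow> 'a"
  assumes emb: "algebra_embedding sE sA \<iota>" "algebra_embedding sE sA \<epsilon>"
    and dim_square: "A.dim UNIV = (E.dim UNIV)\<^sup>2"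
begin

lemma linear: "Vector_Spaces.linear sE sA \<iota>" "Vector_Spaces.linear sE sA \<epsilon>"
  using emb by (auto simp: algebra_embedding_def algebra_hom_def)

lemma hom [simp]:
  "\<iota> (x + y) = \<iota> x + \<iota> y" "\<iota> (x * y) = \<iota> x * \<iota> y" "\<iota> 1 = 1" "\<iota> (sE c x) = sA c (\<iota> x)"
  "\<epsilon> (x + y) = \<epsilon> x + \<epsilon> y" "\<epsilon> (x * y) = \<epsilon> x * \<epsilon> y" "\<epsilon> 1 = 1" "\<epsilon> (sE c x) = sA c (\<epsilon> x)"
  using emb linear[folded module_hom_iff_linear]
  by (auto simp: algebra_embedding_def algebra_hom_def module_hom.add module_hom.scale)

lemma hom_sum: "\<iota> (sum f I) = (\<Sum>i\<in>I. \<iota> (f i))" "\<epsilon> (sum f I) = (\<Sum>i\<in>I. \<epsilon> (f i))"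
  using linear[folded module_hom_iff_linear] by (auto simp: module_hom.sum)

lemma hom_zero [simp]: "\<iota> 0 = 0" "\<epsilon> 0 = 0"
  using linear[folded module_hom_iff_linear] by (auto simp: module_hom.zero)

lemma hom_eq_zero: "\<iota> x = 0 \<longleftrightarrow> x = 0" "\<epsilon> x = 0 \<longleftrightarrow> x = 0"
  using emb inj_eq[of \<iota> x 0] inj_eq[of \<epsilon> x 0] by (simp_all add: algebra_embedding_def)

lemma hom_commute: "\<iota> x * \<iota> y = \<iota> y * \<iota> x" "\<epsilon> x * \<epsilon> y = \<epsilon> y * \<epsilon> x"
  using arg_cong[OF mult.commute[of x y], of \<iota>] arg_cong[OF mult.commute[of x y], of \<epsilon>] by simp_all

text \<open>The image of E tensor E in the endomorphisms of A, a commutative ring.\<close>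

definition ops :: "('a \<Rightarrow> 'a) set" where
  "ops = sandwich_ops (range \<iota>) (range \<epsilon>)"

lemma ops_sandwich: "(\<lambda>z. \<iota> x * z * \<epsilon> y) \<in> ops"
  unfolding ops_def by (intro sandwich_ops.sandwich) auto

lemma ops_left: "\<phi> \<in> ops \<Longrightarrow> (\<lambda>z. \<iota> x * \<phi> z) \<in> ops"
  unfolding ops_def by (intro sandwich_ops_mult_left) (auto simp flip: hom(2,6))

lemma ops_right: "\<phi> \<in> ops \<Longrightarrow> (\<lambda>z. \<phi> z * \<epsilon> y) \<in> ops"
  unfolding ops_def by (intro sandwich_ops_mult_right) (auto simp flip: hom(2,6))

lemma ops_comp: "\<phi> \<in> ops \<Longrightarrow> \<psi> \<in> ops \<Longrightarrow> (\<lambda>z. \<phi> (\<psi> z)) \<in> ops"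
  unfolding ops_def by (rule sandwich_ops_comp) (auto simp flip: hom(2,6))

lemma ops_commute: "\<phi> \<in> ops \<Longrightarrow> \<psi> \<in> ops \<Longrightarrow> \<phi> (\<psi> z) = \<psi> (\<phi> z)"
  unfolding ops_def by (rule sandwich_ops_commute) (auto simp: hom_commute)

lemma ops_zero: "(\<lambda>z. 0) \<in> ops"
  unfolding ops_def by (rule sandwich_ops.zero)

lemma ops_id: "(\<lambda>z. z) \<in> ops"
  using ops_sandwich[of 1 1] by simp

lemma ops_add: "\<phi> \<in> ops \<Longrightarrow> \<psi> \<in> ops \<Longrightarrow> (\<lambda>z. \<phi> z + \<psi> z) \<in> ops"
  unfolding ops_def by (rule sandwich_ops.add)

lemma ops_scale: "\<phi> \<in> ops \<Longrightarrow> (\<lambda>z. sA c (\<phi> z)) \<in> ops"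
  using ops_left[of \<phi> "sE c 1"] by (simp add: A.mult_scale_left)

lemma ops_diff: "\<phi> \<in> ops \<Longrightarrow> \<psi> \<in> ops \<Longrightarrow> (\<lambda>z. \<phi> z - \<psi> z) \<in> ops"
  using ops_add[OF _ ops_scale[of \<psi> "- 1"], of \<phi>] by simp

text \<open>The sub-bimodule generated by \<open>v\<close>, a cyclic module over E tensor E.\<close>

definition orbit :: "'a \<Rightarrow> 'a set" where
  "orbit v = (\<lambda>\<phi>. \<phi> v) ` ops"

lemma orbitI: "\<phi> \<in> ops \<Longrightarrow> \<phi> v \<in> orbit v"
  by (auto simp: orbit_def)

lemma orbit_closed:
  assumes "u \<in> orbit v"
  shows "\<phi> \<in> ops \<Longrightarrow> \<phi> u \<in> orbit v" "\<iota> x * u \<in> orbit v" "u * \<epsilon> y \<in> orbit v"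
proof -
  obtain \<psi> where \<psi>: "\<psi> \<in> ops" "u = \<psi> v"
    using assms by (auto simp: orbit_def)
  show "\<phi> \<in> ops \<Longrightarrow> \<phi> u \<in> orbit v" "\<iota> x * u \<in> orbit v" "u * \<epsilon> y \<in> orbit v"
    using orbitI[OF ops_comp[OF _ \<psi>(1)], of \<phi>] orbitI[OF ops_left[OF \<psi>(1)], of x v]
      orbitI[OF ops_right[OF \<psi>(1)], of v y] \<psi>(2) by auto
qed

lemma subspace_orbit: "A.subspace (orbit v)"
proof (rule A.subspaceI)
  show "0 \<in> orbit v"
    using orbitI[OF ops_zero] by simp
  fix u w assume "u \<in> orbit v" "w \<in> orbit v"
  then obtain \<phi> \<psi> where "\<phi> \<in> ops" "u = \<phi> v" "\<psi> \<in> ops" "w = \<psi> v"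
    by (auto simp: orbit_def)
  then show "u + w \<in> orbit v" "sA c u \<in> orbit v" for c
    using orbitI[OF ops_add, of \<phi> \<psi> v] orbitI[OF ops_scale, of \<phi> c v] by auto
qed

text \<open>An L-linear right inverse of the evaluation map from \<open>ops\<close> onto
  \<open>orbit v\<close>; outside \<open>orbit v\<close> its values are arbitrary.\<close>

definition linear_section :: "'a \<Rightarrow> ('a \<Rightarrow> 'a \<Rightarrow> 'a) \<Rightarrow> bool" where
  "linear_section v s \<longleftrightarrow>
     (\<forall>u\<in>orbit v. s u \<in> ops \<and> s u v = u) \<and>
     (\<forall>u\<in>orbit v. \<forall>w\<in>orbit v. \<forall>z. s (u + w) z = s u z + s w z) \<and>
     (\<forall>c. \<forall>u\<in>orbit v. \<forall>z. s (sA c u) z = sA c (s u z))"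

text \<open>Preimages are chosen for a basis of the orbit and extended linearly.\<close>

lemma linear_section_exists: "\<exists>s. linear_section v s"
proof -
  obtain D where D: "D \<subseteq> orbit v" "A.independent D" "orbit v \<subseteq> A.span D"
    by (metis A.basis_exists)
  have span: "A.span D = orbit v"
    using D by (simp add: A.span_minimal subset_antisym subspace_orbit)
  have fin: "finite D"
    using A.finite_dimensional A.independent_span_bound[OF _ D(2)] by auto
  obtain \<Phi> where \<Phi>: "\<And>d. d \<in> D \<Longrightarrow> \<Phi> d \<in> ops \<and> \<Phi> d v = d"
  proof -
    have "\<forall>d\<in>D. \<exists>\<phi>. \<phi> \<in> ops \<and> \<phi> v = d"
      using D(1) by (auto simp: orbit_def)
    then show ?thesis
      using that by metis
  qed
  define s where "s u = (\<lambda>z. \<Sum>d\<in>D. sA (A.representation D u d) (\<Phi> d z))" for u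
  have "s u \<in> ops" for u
    unfolding s_def ops_def
    by (intro sandwich_ops_sum) (use \<Phi> ops_scale in \<open>auto simp: ops_def\<close>)
  moreover have "s u v = u" if "u \<in> orbit v" for u
  proof -
    have "s u v = (\<Sum>d\<in>D. sA (A.representation D u d) d)"
      unfolding s_def using \<Phi> by (intro sum.cong) auto
    then show ?thesis
      using A.sum_representation_eq[OF D(2) _ fin] that span by simp
  qed
  moreover have "s (u + w) z = s u z + s w z" if "u \<in> orbit v" "w \<in> orbit v" for u w z
    using that by (simp add: s_def span A.representation_add[OF D(2)] A.scale_left_distrib sum.distrib)
  moreover have "s (sA c u) z = sA c (s u z)" if "u \<in> orbit v" for c u z
    using that by (simp add: s_def span A.representation_scale[OF D(2)] A.scale_sum_right)
  ultimately show ?thesis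
    unfolding linear_section_def by blast
qed

text \<open>Averaging a linear section over the separability element makes it linear over \<open>E\<close> on both
  sides; its value at \<open>v\<close> is an idempotent whose complement generates the annihilator of \<open>v\<close>.\<close>

lemma annihilator_idempotent:
  "\<exists>g\<in>ops. g v = v \<and> (\<forall>\<phi>\<in>ops. \<phi> v = 0 \<longrightarrow> (\<forall>z. \<phi> (g z) = 0))"
proof -
  obtain ps :: "('e \<times> 'e) list" where ps: "tensor_sum (*) ps = 1"
    "\<And>x. commutes_with (Collect (balanced sE) :: ('e \<Rightarrow> 'e \<Rightarrow> 'a) set) ps x"
    using E.separability_element by blast
  obtain s0 where "linear_section v s0"
    using linear_section_exists by blast
  then have s0: "\<And>u. u \<in> orbit v \<Longrightarrow> s0 u \<in> ops" "\<And>u. u \<in> orbit v \<Longrightarrow> s0 u v = u"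
    "\<And>u w z. u \<in> orbit v \<Longrightarrow> w \<in> orbit v \<Longrightarrow> s0 (u + w) z = s0 u z + s0 w z"
    "\<And>c u z. u \<in> orbit v \<Longrightarrow> s0 (sA c u) z = sA c (s0 u z)"
    by (auto simp: linear_section_def)
  have add_mem: "u + w \<in> orbit v" if "u \<in> orbit v" "w \<in> orbit v" for u w
    using that A.subspace_add[OF subspace_orbit] by blast
  have one: "tensor_sum (\<lambda>x y. \<iota> x * \<iota> y) ps = 1" "tensor_sum (\<lambda>x y. \<epsilon> x * \<epsilon> y) ps = 1"
    using arg_cong[OF ps(1), of \<iota>] arg_cong[OF ps(1), of \<epsilon>]
      tensor_sum_hom[of \<iota> "(*)" ps] tensor_sum_hom[of \<epsilon> "(*)" ps] by auto
  \<comment> \<open>First average: the sum of x s(y u) over the separability element is linear over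
    E for the left action.\<close>
  define s1 where "s1 u = (\<lambda>z. tensor_sum (\<lambda>x y. \<iota> x * s0 (\<iota> y * u) z) ps)" for u
  have s1_ops: "s1 u \<in> ops" if "u \<in> orbit v" for u
    unfolding s1_def ops_def
    by (intro sandwich_ops_tensor_sum)
      (use that s0(1) orbit_closed ops_left in \<open>auto simp: ops_def\<close>)
  have s1_section: "s1 u v = u" if "u \<in> orbit v" for u
  proof -
    have "s1 u v = tensor_sum (\<lambda>x y. \<iota> x * \<iota> y * u) ps"
      unfolding s1_def using that by (intro tensor_sum_cong) (simp add: s0 orbit_closed mult.assoc)
    also have "\<dots> = tensor_sum (\<lambda>x y. \<iota> x * \<iota> y) ps * u"
      by (rule tensor_sum_hom[symmetric]) (simp add: distrib_right)
    finally show ?thesis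
      by (simp add: one)
  qed
  have s1_add: "s1 (u + w) z = s1 u z + s1 w z" if "u \<in> orbit v" "w \<in> orbit v" for u w z
    using that by (simp add: s1_def distrib_left s0 orbit_closed tensor_sum_add)
  have s1_scale: "s1 (sA c u) z = sA c (s1 u z)" if "u \<in> orbit v" for c u z
  proof -
    have "s1 (sA c u) z = tensor_sum (\<lambda>x y. sA c (\<iota> x * s0 (\<iota> y * u) z)) ps"
      unfolding s1_def using that
      by (intro tensor_sum_cong) (simp add: A.mult_scale_right s0 orbit_closed)
    also have "\<dots> = sA c (s1 u z)"
      unfolding s1_def by (rule tensor_sum_hom[symmetric]) (simp add: A.scale_right_distrib)
    finally show ?thesis .
  qed
  have s1_left: "s1 (\<iota> a * u) z = \<iota> a * s1 u z" if u: "u \<in> orbit v" for a u z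
  proof -
    let ?\<beta> = "\<lambda>x y. \<iota> x * s0 (\<iota> y * u) z"
    have "balanced sE ?\<beta>"
      using u by (simp add: balanced_def distrib_left distrib_right s0 orbit_closed
          A.mult_scale_left A.mult_scale_right)
    then have "tensor_sum (\<lambda>x y. ?\<beta> (a * x) y) ps = tensor_sum (\<lambda>x y. ?\<beta> x (a * y)) ps"
      using commutes_withD[OF ps(2), of ?\<beta>] by simp
    moreover have "tensor_sum (\<lambda>x y. ?\<beta> x (a * y)) ps = s1 (\<iota> a * u) z"
      unfolding s1_def by (simp only: mult.commute[of a] hom mult.assoc)
    moreover have "tensor_sum (\<lambda>x y. ?\<beta> (a * x) y) ps = \<iota> a * s1 u z"
      unfolding s1_def
      by (subst tensor_sum_hom[of "\<lambda>w. \<iota> a * w"]) (simp_all add: distrib_left mult.assoc)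
    ultimately show ?thesis
      by simp
  qed
  \<comment> \<open>Second average, over the right action; left linearity is inherited from
    \<open>s1\<close> because the two actions commute.\<close>
  define s2 where "s2 u = (\<lambda>z. tensor_sum (\<lambda>x y. s1 (u * \<epsilon> y) z * \<epsilon> x) ps)" for u
  have s2_ops: "s2 u \<in> ops" if "u \<in> orbit v" for u
    unfolding s2_def ops_def
    by (intro sandwich_ops_tensor_sum)
      (use that s1_ops orbit_closed ops_right in \<open>auto simp: ops_def\<close>)
  have s2_section: "s2 u v = u" if "u \<in> orbit v" for u
  proof -
    have "s2 u v = tensor_sum (\<lambda>x y. u * (\<epsilon> x * \<epsilon> y)) ps"
      unfolding s2_def using that
      by (intro tensor_sum_cong) (simp add: s1_section orbit_closed mult.assoc hom_commute)
    also have "\<dots> = u * tensor_sum (\<lambda>x y. \<epsilon> x * \<epsilon> y) ps"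
      by (rule tensor_sum_hom[symmetric]) (simp add: distrib_left)
    finally show ?thesis
      by (simp add: one)
  qed
  have s2_add: "s2 (u + w) z = s2 u z + s2 w z" if "u \<in> orbit v" "w \<in> orbit v" for u w z
    using that by (simp add: s2_def distrib_right s1_add orbit_closed tensor_sum_add)
  have s2_left: "s2 (\<iota> a * u) z = \<iota> a * s2 u z" if u: "u \<in> orbit v" for a u z
  proof -
    have "s2 (\<iota> a * u) z = tensor_sum (\<lambda>x y. \<iota> a * (s1 (u * \<epsilon> y) z * \<epsilon> x)) ps"
      unfolding s2_def using u
      by (intro tensor_sum_cong) (simp add: s1_left orbit_closed mult.assoc)
    also have "\<dots> = \<iota> a * s2 u z"
      unfolding s2_def by (rule tensor_sum_hom[symmetric]) (simp add: distrib_left)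
    finally show ?thesis .
  qed
  have s2_right: "s2 (u * \<epsilon> a) z = s2 u z * \<epsilon> a" if u: "u \<in> orbit v" for a u z
  proof -
    let ?\<beta> = "\<lambda>x y. s1 (u * \<epsilon> y) z * \<epsilon> x"
    have "balanced sE ?\<beta>"
      using u by (simp add: balanced_def distrib_left distrib_right s1_add s1_scale orbit_closed
          A.mult_scale_left A.mult_scale_right)
    then have "tensor_sum (\<lambda>x y. ?\<beta> (a * x) y) ps = tensor_sum (\<lambda>x y. ?\<beta> x (a * y)) ps"
      using commutes_withD[OF ps(2), of ?\<beta>] by simp
    moreover have "tensor_sum (\<lambda>x y. ?\<beta> x (a * y)) ps = s2 (u * \<epsilon> a) z"
      unfolding s2_def by (simp only: hom mult.assoc)
    moreover have "tensor_sum (\<lambda>x y. ?\<beta> (a * x) y) ps = s2 u z * \<epsilon> a"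
      unfolding s2_def
      by (subst tensor_sum_hom[of "\<lambda>w. w * \<epsilon> a"])
        (simp_all add: distrib_right mult.assoc hom_commute)
    ultimately show ?thesis
      by simp
  qed
  have "0 \<in> orbit v"
    using orbitI[OF ops_zero] by simp
  then have s2_zero: "s2 0 z = 0" for z
    using s2_add[of 0 0 z] by simp
  \<comment> \<open>Linearity over both actions extends to all of \<open>ops\<close>. At u = v it
    shows that an operator killing \<open>v\<close> also kills the values of
    \<open>s2 v\<close>.\<close>
  have equivariant: "s2 (\<phi> u) z = \<phi> (s2 u z)" if "\<phi> \<in> ops" and u: "u \<in> orbit v" for \<phi> u z
    using that(1)[unfolded ops_def]
  proof induction
    case (sandwich x y)
    then show ?case
      using u by (auto simp: s2_left s2_right orbit_closed)
  next
    case (add \<phi> \<psi>)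
    then show ?case
      using u by (simp add: s2_add orbit_closed(1)[unfolded ops_def])
  qed (simp add: s2_zero)
  have v: "v \<in> orbit v"
    using orbitI[OF ops_id] by simp
  show ?thesis
  proof (intro bexI conjI ballI impI allI)
    show "s2 v \<in> ops" "s2 v v = v"
      using v by (auto simp: s2_ops s2_section)
    show "\<phi> (s2 v z) = 0" if "\<phi> \<in> ops" "\<phi> v = 0" for \<phi> z
      using equivariant[OF that(1) v] that(2) s2_zero by simp
  qed
qed

text \<open>The vector \<open>v\<close> is chosen in \<open>J\<close> with orbit of largest
  dimension. If \<open>\<phi>\<close> kills \<open>v\<close> but not \<open>w\<close>, then with
  \<open>g\<close> the idempotent of \<open>v\<close> the vector u = w - g w lies outside the orbit
  of \<open>v\<close>, while the orbit of v + u contains both \<open>v\<close> and \<open>u\<close>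
  and is strictly larger.\<close>

lemma generic_vector:
  assumes J: "J \<noteq> {}" "\<And>u w. u \<in> J \<Longrightarrow> w \<in> J \<Longrightarrow> u + w \<in> J" "\<And>u w. u \<in> J \<Longrightarrow> w \<in> J \<Longrightarrow> u - w \<in> J"
    "\<And>\<phi> u. \<phi> \<in> ops \<Longrightarrow> u \<in> J \<Longrightarrow> \<phi> u \<in> J"
  shows "\<exists>v\<in>J. \<forall>\<phi>\<in>ops. \<phi> v = 0 \<longrightarrow> (\<forall>w\<in>J. \<phi> w = 0)"
proof -
  obtain B where "finite_dimensional_vector_space sA B"
    by (rule A.finite_basis_exists[OF A.finite_dimensional])
  then interpret fd: finite_dimensional_vector_space sA B .
  obtain v0 where v0: "v0 \<in> J"
    using J(1) by blast
  have "\<exists>v. v \<in> J \<and> (\<forall>u. u \<in> J \<longrightarrow> A.dim (orbit u) \<le> A.dim (orbit v))"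
    by (rule ex_has_greatest_nat[of _ v0 _ "Suc fd.dimension"])
      (use v0 fd.dim_subset_UNIV in \<open>auto simp: less_Suc_eq_le\<close>)
  then obtain v where v: "v \<in> J" "\<And>u. u \<in> J \<Longrightarrow> A.dim (orbit u) \<le> A.dim (orbit v)"
    by blast
  have "\<phi> w = 0" if \<phi>: "\<phi> \<in> ops" "\<phi> v = 0" and w: "w \<in> J" for \<phi> w
  proof (rule ccontr)
    assume ne: "\<phi> w \<noteq> 0"
    obtain g where g: "g \<in> ops" "g v = v" "\<And>\<psi> z. \<psi> \<in> ops \<Longrightarrow> \<psi> v = 0 \<Longrightarrow> \<psi> (g z) = 0"
      using annihilator_idempotent[of v] by blast
    \<comment> \<open>The operator id - g kills \<open>v\<close>, hence it kills every
      \<open>g z\<close>.\<close>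
    have idem: "g (g z) = g z" for z
      using g(3)[OF ops_diff[OF ops_id g(1)], of z] g(2) by simp
    define u where "u = w - g w"
    have gu: "g u = 0"
      using sandwich_ops_diff[OF g(1)[unfolded ops_def], of w "g w"] idem by (simp add: u_def)
    have vu: "g (v + u) = v"
      using sandwich_ops_add[OF g(1)[unfolded ops_def], of v u] g(2) gu by simp
    have "v \<in> orbit (v + u)"
      using orbitI[OF g(1), of "v + u"] vu by simp
    then have sub: "orbit v \<subseteq> orbit (v + u)"
      by (auto simp: orbit_def[of v] intro: orbit_closed)
    have "u \<in> orbit (v + u)"
      using A.subspace_diff[OF subspace_orbit orbitI[OF ops_id] \<open>v \<in> orbit (v + u)\<close>] by simp
    moreover have "u \<notin> orbit v"
    proof
      assume "u \<in> orbit v"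
      then obtain \<psi> where \<psi>: "\<psi> \<in> ops" "u = \<psi> v"
        by (auto simp: orbit_def)
      \<comment> \<open>From u = \<psi> v follows g u = \<psi> (g v) = u, whereas g u = 0.\<close>
      have "u = 0"
        using ops_commute[OF g(1) \<psi>(1), of v] gu g(2) \<psi>(2) by simp
      then have "\<phi> w = 0"
        using g(3)[OF \<phi>, of w] by (simp add: u_def)
      then show False
        using ne by simp
    qed
    ultimately have "A.span (orbit v) \<subset> A.span (orbit (v + u))"
      using sub subspace_orbit by (metis A.span_eq_iff psubsetI)
    then have "A.dim (orbit v) < A.dim (orbit (v + u))"
      by (rule fd.dim_psubset)
    moreover have "v + u \<in> J"
      unfolding u_def using v(1) w J g(1) by blast
    ultimately show False
      using v(2) by fastforce
  qed
  then show ?thesis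
    using v(1) by blast
qed

end

text \<open>Stated for an indexed family so that the size of the image is controlled too: a
  repetition f i = f j would be a relation with coefficients 1 and -1.\<close>

lemma (in vector_space) independent_family:
  assumes "finite I" and zero: "\<And>c i. (\<Sum>i\<in>I. scale (c i) (f i)) = 0 \<Longrightarrow> i \<in> I \<Longrightarrow> c i = 0"
  shows "inj_on f I" "independent (f ` I)"
proof -
  show inj: "inj_on f I"
  proof (rule inj_onI, rule ccontr)
    fix i j assume ij: "i \<in> I" "j \<in> I" "f i = f j" "i \<noteq> j"
    define c :: "_ \<Rightarrow> 'a" where "c = (\<lambda>k. if k = i then 1 else if k = j then - 1 else 0)"
    have "(\<Sum>k\<in>I. scale (c k) (f k)) = (\<Sum>k\<in>{i, j}. scale (c k) (f k))"
      using ij assms(1) by (intro sum.mono_neutral_right) (auto simp: c_def)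
    also have "\<dots> = 0"
      using ij by (simp add: c_def)
    finally have "c i = 0"
      using zero ij(1) by blast
    then show False
      by (simp add: c_def)
  qed
  show "independent (f ` I)"
  proof (rule independent_if_scalars_zero)
    fix c x assume "(\<Sum>x\<in>f ` I. scale (c x) x) = 0" "x \<in> f ` I"
    then show "c x = 0"
      using zero[of "\<lambda>i. c (f i)"] by (auto simp: sum.reindex[OF inj])
  qed (simp add: assms(1))
qed

section \<open>Freeness of rank one and the unit intertwiner\<close>

context etale_embedding_pair
begin

text \<open>Every element of E tensor E is a sum of tensors b tensor t(b). As the
  \<open>\<iota> b\<close> are independent over L, no nonzero element of E tensor E can kill a left
  ideal \<open>J\<close> on which E acts faithfully from the right.\<close>

lemma basis_combination_zero:
  assumes B: "finite B" "E.independent B"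
    and J: "\<And>r w. w \<in> J \<Longrightarrow> r * w \<in> J"
    and faithful: "\<And>x. (\<And>w. w \<in> J \<Longrightarrow> w * \<epsilon> x = 0) \<Longrightarrow> x = 0"
    and zero: "\<And>w. w \<in> J \<Longrightarrow> (\<Sum>b\<in>B. \<iota> b * w * \<epsilon> (t b)) = 0"
    and b: "b \<in> B"
  shows "t b = 0"
proof (rule faithful)
  fix w assume w: "w \<in> J"
  have inj: "inj \<iota>"
    using emb by (simp add: algebra_embedding_def)
  have indep: "A.independent (\<iota> ` B)"
  proof (rule A.independent_family)
    fix c i assume "(\<Sum>b\<in>B. sA (c b) (\<iota> b)) = 0" "i \<in> B"
    moreover from this have "\<iota> (\<Sum>b\<in>B. sE (c b) b) = 0"
      by (simp add: hom_sum)
    ultimately show "c i = 0"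
      using E.independentD[OF B(2,1) order_refl] by (simp add: hom_eq_zero)
  qed fact
  define t' where "t' = (\<lambda>a. \<epsilon> (t (inv \<iota> a)))"
  have "w * t' (\<iota> b) = 0"
  proof (rule A.annihilated_left_ideal[where B = "\<iota> ` B" and J = J and t = t'])
    show "(\<Sum>a\<in>\<iota> ` B. a * u * t' a) = 0" if "u \<in> J" for u
      using zero[OF that] inj by (simp add: t'_def sum.reindex[OF inj_on_subset[OF inj]])
  qed (use B b J w indep in auto)
  then show "w * \<epsilon> (t b) = 0"
    using inj by (simp add: t'_def)
qed

text \<open>An operator killing a generic vector \<open>v\<close> of \<open>J\<close> kills
  \<open>J\<close>, hence is zero. So the vectors \<iota>(b) v \<epsilon>(d), with \<open>b\<close>
  and \<open>d\<close> in a basis of E, are independent; their number is dim A, so they span A, and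
  they lie in \<open>J\<close>. Applied to A itself this yields a free generator, applied to A h it
  makes \<open>h\<close> invertible.\<close>

lemma faithful_ideal_full:
  assumes J: "0 \<in> J" "\<And>u w. u \<in> J \<Longrightarrow> w \<in> J \<Longrightarrow> u + w \<in> J"
    "\<And>r w. w \<in> J \<Longrightarrow> r * w \<in> J" "\<And>w y. w \<in> J \<Longrightarrow> w * \<epsilon> y \<in> J"
    and faithful: "\<And>x. (\<And>w. w \<in> J \<Longrightarrow> w * \<epsilon> x = 0) \<Longrightarrow> x = 0"
  shows "\<exists>v. orbit v = UNIV \<and> (\<forall>\<phi>\<in>ops. \<phi> v = 0 \<longrightarrow> (\<forall>w. \<phi> w = 0))" "J = UNIV"
proof -
  obtain B where B: "finite B" "E.independent B" "E.span B = UNIV" "card B = E.dim UNIV"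
    by (rule E.finite_basis_exists[OF E.finite_dimensional])
  obtain C where "finite_dimensional_vector_space sA C"
    by (rule A.finite_basis_exists[OF A.finite_dimensional])
  then interpret fd: finite_dimensional_vector_space sA C .
  have stable: "\<phi> u \<in> J" if "\<phi> \<in> ops" "u \<in> J" for \<phi> u
    using that(1)[unfolded ops_def] by induction (use J that(2) in auto)
  have diff: "u - w \<in> J" if "u \<in> J" "w \<in> J" for u w
    using J(2)[OF that(1) J(3)[OF that(2), of "- 1"]] by simp
  have "\<exists>v\<in>J. \<forall>\<phi>\<in>ops. \<phi> v = 0 \<longrightarrow> (\<forall>w\<in>J. \<phi> w = 0)"
  proof (rule generic_vector)
    show "J \<noteq> {}"
      using J(1) by blast
  qed (fact J(2) diff stable)+
  then obtain v where v: "v \<in> J" "\<And>\<phi> w. \<phi> \<in> ops \<Longrightarrow> \<phi> v = 0 \<Longrightarrow> w \<in> J \<Longrightarrow> \<phi> w = 0"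
    by blast
  define f where "f = (\<lambda>(b, d). \<iota> b * v * \<epsilon> d)"
  have coeff: "c p = 0" if c: "(\<Sum>p\<in>B \<times> B. sA (c p) (f p)) = 0" and p: "p \<in> B \<times> B" for c p
  proof -
    \<comment> \<open>Collecting the terms with the same first index turns the relation into an
      operator of \<open>ops\<close> killing \<open>v\<close>.\<close>
    define t where "t b = (\<Sum>d\<in>B. sE (c (b, d)) d)" for b
    have ops: "(\<lambda>z. \<Sum>b\<in>B. \<iota> b * z * \<epsilon> (t b)) \<in> ops"
      unfolding ops_def by (intro sandwich_ops_sum sandwich_ops.sandwich) auto
    have "(\<Sum>b\<in>B. \<iota> b * v * \<epsilon> (t b)) = (\<Sum>p\<in>B \<times> B. sA (c p) (f p))"
      by (simp add: t_def f_def hom_sum sum_distrib_left A.mult_scale_right sum.cartesian_product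
          case_prod_unfold)
    then have "(\<Sum>b\<in>B. \<iota> b * v * \<epsilon> (t b)) = 0"
      using c by simp
    note v(2)[OF ops this]
    then have "t (fst p) = 0"
      using basis_combination_zero[OF B(1,2) J(3) faithful, of t "fst p"] p by auto
    then show ?thesis
      unfolding t_def using E.independentD[OF B(2,1) order_refl, of "\<lambda>d. c (fst p, d)" "snd p"] p
      by auto
  qed
  have fam: "inj_on f (B \<times> B)" "A.independent (f ` (B \<times> B))"
    by (rule A.independent_family; use B(1) coeff in blast)+
  have "card (f ` (B \<times> B)) = A.dim (UNIV :: 'a set)"
    by (simp only: card_image[OF fam(1)] card_cartesian_product B(4) dim_square power2_eq_square)
  then have "UNIV \<subseteq> A.span (f ` (B \<times> B))"
    by (intro fd.card_ge_dim_independent fam(2)) (simp_all del: fd.dim_UNIV)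
  moreover have "A.span (f ` (B \<times> B)) \<subseteq> orbit v"
    using orbitI[OF ops_sandwich, of _ v]
    by (intro A.span_minimal subspace_orbit) (auto simp: f_def)
  ultimately have orbit: "orbit v = UNIV"
    by blast
  moreover have "orbit v \<subseteq> J"
    using stable v(1) by (auto simp: orbit_def)
  ultimately show "J = UNIV"
    by blast
  then show "\<exists>v. orbit v = UNIV \<and> (\<forall>\<phi>\<in>ops. \<phi> v = 0 \<longrightarrow> (\<forall>w. \<phi> w = 0))"
    using orbit v(2) by (intro exI[of _ v]) auto
qed

text \<open>Normal form of an element of E tensor E. One family \<open>t\<close> serves both for the
  action on A and for the multiplication of E, so that vanishing of the former can be carried over
  to the latter.\<close>

lemma tensor_sum_basis:
  assumes B: "finite B" "E.independent B" "E.span B = UNIV"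
  shows "\<exists>t. (\<forall>w. tensor_sum (\<lambda>x y. \<iota> x * w * \<epsilon> y) ps = (\<Sum>b\<in>B. \<iota> b * w * \<epsilon> (t b))) \<and>
     tensor_sum (*) ps = (\<Sum>b\<in>B. b * t b)"
proof (induction ps)
  case Nil
  show ?case
    by (auto intro!: exI[of _ "\<lambda>b. 0"])
next
  case (Cons p ps)
  obtain x y where p: "p = (x, y)"
    by (cases p)
  obtain t where t: "\<And>w. tensor_sum (\<lambda>x y. \<iota> x * w * \<epsilon> y) ps = (\<Sum>b\<in>B. \<iota> b * w * \<epsilon> (t b))"
    "tensor_sum (*) ps = (\<Sum>b\<in>B. b * t b)"
    using Cons by blast
  define c where "c = E.representation B x"
  have x: "x = (\<Sum>b\<in>B. sE (c b) b)"
    using E.sum_representation_eq[OF B(2), of x B] B by (simp add: c_def)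
  have 1: "\<iota> x * w * \<epsilon> y = (\<Sum>b\<in>B. \<iota> b * w * \<epsilon> (sE (c b) y))" for w
    by (subst x) (simp add: hom_sum sum_distrib_right A.mult_scale_left A.mult_scale_right)
  have 2: "x * y = (\<Sum>b\<in>B. b * sE (c b) y)"
    by (subst x) (simp add: sum_distrib_right E.mult_scale_left E.mult_scale_right)
  show ?case
    by (intro exI[of _ "\<lambda>b. sE (c b) y + t b"])
      (simp add: p 1 2 t distrib_left sum.distrib del: hom(8))
qed

text \<open>E tensor E acts faithfully on A, so an element acting as zero is zero, and so is its
  image under multiplication.\<close>

lemma tensor_sum_eq_zero:
  assumes "\<And>w. tensor_sum (\<lambda>x y. \<iota> x * w * \<epsilon> y) ps = 0"
  shows "tensor_sum (*) ps = 0"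
proof -
  obtain B where B: "finite B" "E.independent B" "E.span B = UNIV"
    by (rule E.finite_basis_exists[OF E.finite_dimensional])
  obtain t where t: "\<And>w. tensor_sum (\<lambda>x y. \<iota> x * w * \<epsilon> y) ps = (\<Sum>b\<in>B. \<iota> b * w * \<epsilon> (t b))"
    "tensor_sum (*) ps = (\<Sum>b\<in>B. b * t b)"
    using tensor_sum_basis[OF B, of ps] by blast
  have "t b = 0" if "b \<in> B" for b
  proof (rule basis_combination_zero[where J = UNIV and t = t and B = B])
    show "x = 0" if "\<And>w. w \<in> UNIV \<Longrightarrow> w * \<epsilon> x = 0" for x
      using that[of 1] by (simp add: hom_eq_zero)
    show "(\<Sum>b\<in>B. \<iota> b * w * \<epsilon> (t b)) = 0" for w
      using assms t(1) by simp
  qed (use that B in auto)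
  then show ?thesis
    by (simp add: t(2))
qed

text \<open>The average \<open>h\<close> of a generator of \<open>A\<close> as an \<open>E\<close>-\<open>E\<close>-bimodule is a unit, because \<open>A h\<close> is a
  left ideal on which \<open>E\<close> acts faithfully from the right.\<close>

proposition unit_intertwiner:
  "\<exists>h z. (\<forall>x. \<iota> x * h = h * \<epsilon> x) \<and> h * z = 1 \<and> z * h = 1 \<and>
     (\<forall>k. (\<forall>x. \<iota> x * k = k * \<epsilon> x) \<longrightarrow> (\<exists>x. k = \<iota> x * h))"
proof -
  obtain ps :: "('e \<times> 'e) list" where ps: "tensor_sum (*) ps = 1"
    "\<And>x. commutes_with (Collect (balanced sE) :: ('e \<Rightarrow> 'e \<Rightarrow> 'a) set) ps x"
    using E.separability_element by blast
  have "x = 0" if "\<And>w. w \<in> UNIV \<Longrightarrow> w * \<epsilon> x = 0" for x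
    using that[of 1] by (simp add: hom_eq_zero)
  then obtain a where a: "orbit a = UNIV" "\<And>\<phi> w. \<phi> \<in> ops \<Longrightarrow> \<phi> a = 0 \<Longrightarrow> \<phi> w = 0"
    using faithful_ideal_full(1)[of UNIV] by auto
  \<comment> \<open>The action of the separability element; it projects A onto the intertwiners of
    \<iota> and \<epsilon>.\<close>
  define P where "P = (\<lambda>w. tensor_sum (\<lambda>x y. \<iota> x * w * \<epsilon> y) ps)"
  have P_ops: "P \<in> ops"
    unfolding P_def ops_def by (intro sandwich_ops_tensor_sum sandwich_ops.sandwich) auto
  have P_left: "\<iota> x * P w = tensor_sum (\<lambda>a b. \<iota> (x * a) * w * \<epsilon> b) ps" for x w
    unfolding P_def by (subst tensor_sum_hom[of "\<lambda>w. \<iota> x * w"]) (simp_all add: distrib_left mult.assoc)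
  have P_inter: "\<iota> x * P w = P w * \<epsilon> x" for x w
  proof -
    let ?\<beta> = "\<lambda>a b. \<iota> a * w * \<epsilon> b"
    have "balanced sE ?\<beta>"
      by (simp add: balanced_def distrib_left distrib_right A.mult_scale_left A.mult_scale_right)
    then have "\<iota> x * P w = tensor_sum (\<lambda>a b. ?\<beta> a (x * b)) ps"
      using commutes_withD[OF ps(2), of ?\<beta>] by (simp only: P_left mem_Collect_eq)
    also have "\<dots> = P w * \<epsilon> x"
      unfolding P_def
      by (subst tensor_sum_hom[of "\<lambda>w. w * \<epsilon> x"])
        (simp_all add: distrib_right mult.assoc hom_commute)
    finally show ?thesis .
  qed
  define h where "h = P a"
  have inter: "\<iota> x * h = h * \<epsilon> x" for x
    by (simp add: h_def P_inter)
  have "range (\<lambda>r. r * h) = UNIV"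
  proof (rule faithful_ideal_full(2))
    show "0 \<in> range (\<lambda>r. r * h)"
      using rangeI[of "\<lambda>r. r * h" 0] by simp
    show "u + w \<in> range (\<lambda>r. r * h)" if "u \<in> range (\<lambda>r. r * h)" "w \<in> range (\<lambda>r. r * h)" for u w
      using that by (auto simp flip: distrib_right)
    show "r * w \<in> range (\<lambda>r. r * h)" if "w \<in> range (\<lambda>r. r * h)" for r w
      using that by (auto simp flip: mult.assoc)
    show "w * \<epsilon> y \<in> range (\<lambda>r. r * h)" if w: "w \<in> range (\<lambda>r. r * h)" for w y
    proof -
      obtain r where "w = r * h"
        using w by blast
      then have "w * \<epsilon> y = (r * \<iota> y) * h"
        by (simp add: mult.assoc inter)
      then show ?thesis
        by blast
    qed
    show "x = 0" if "\<And>w. w \<in> range (\<lambda>r. r * h) \<Longrightarrow> w * \<epsilon> x = 0" for x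
    proof -
      \<comment> \<open>From h \<epsilon>(x) = 0 the operator \<iota>(x) P kills the generator
        \<open>a\<close>, hence is zero. So x tensor 1 times the separability element acts as zero,
        and its diagonal value is \<open>x\<close>.\<close>
      have "\<iota> x * P a = 0"
        using that[of h] rangeI[of "\<lambda>r. r * h" 1] by (simp add: h_def P_inter)
      then have "\<iota> x * P w = 0" for w
        using a(2)[OF ops_left[OF P_ops]] by blast
      then have "tensor_sum (\<lambda>a b. \<iota> a * w * \<epsilon> b) (map (\<lambda>(a, b). (x * a, b)) ps) = 0" for w
        by (simp only: tensor_sum_map P_left)
      then have "tensor_sum (*) (map (\<lambda>(a, b). (x * a, b)) ps) = 0"
        by (rule tensor_sum_eq_zero)
      moreover have "tensor_sum (*) (map (\<lambda>(a, b). (x * a, b)) ps) = x * tensor_sum (*) ps"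
        unfolding tensor_sum_map
        by (subst tensor_sum_hom[of "\<lambda>w. x * w"])
          (auto simp: distrib_left mult.assoc intro: tensor_sum_cong)
      ultimately show ?thesis
        using ps(1) by simp
    qed
  qed
  then have "1 \<in> range (\<lambda>r. r * h)"
    by simp
  then obtain z where z: "z * h = 1"
    by force
  have "\<exists>x. k = \<iota> x * h" if k: "\<And>x. \<iota> x * k = k * \<epsilon> x" for k
  proof -
    have "k \<in> orbit a"
      using a(1) by simp
    then obtain \<phi> where \<phi>: "\<phi> \<in> ops" "k = \<phi> a"
      by (auto simp: orbit_def)
    \<comment> \<open>An intertwiner is fixed by \<open>P\<close>, so k = P (\<phi> a) = \<phi> (P
      a) = \<phi> h. On \<open>h\<close> the right action can be rewritten as the left one.\<close>
    have "P k = tensor_sum (\<lambda>x y. k * \<epsilon> (x * y)) ps"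
      unfolding P_def by (intro tensor_sum_cong) (simp add: k mult.assoc)
    also have "\<dots> = k * \<epsilon> (tensor_sum (*) ps)"
      by (rule tensor_sum_hom[of "\<lambda>w. k * \<epsilon> w", symmetric]) (simp add: distrib_left)
    finally have "k = \<phi> h"
      using ops_commute[OF P_ops \<phi>(1), of a] by (simp add: ps(1) \<phi>(2) h_def)
    moreover have "\<exists>x. \<phi> h = \<iota> x * h"
      using \<phi>(1)[unfolded ops_def]
    proof induction
      case zero
      show ?case
        by (intro exI[of _ 0]) simp
    next
      case (sandwich x y)
      then obtain x' y' where "x = \<iota> x'" "y = \<epsilon> y'"
        by blast
      then have "x * h * y = \<iota> (x' * y') * h"
        using inter[of y'] by (simp add: mult.assoc)
      then show ?case
        by blast
    next
      case (add \<phi> \<psi>)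
      then show ?case
        by (metis hom(1) distrib_right)
    qed
    ultimately show ?thesis
      by simp
  qed
  then show ?thesis
    using inter z A.left_inverse_imp_right_inverse[OF A.finite_dimensional z] by blast
qed

end

text \<open>Elements commuting with the image are intertwiners of \<epsilon> with itself, all of the
  form \<epsilon>(y) h. For the element 1 this gives 1 = \<epsilon>(x) h, which makes
  \<open>x\<close> a non-zero-divisor, hence a unit of E, and places \<open>h\<close> in the
  image.\<close>

lemma centralizer_eq_range:
  assumes "etale_embedding_pair sA sE \<epsilon> \<epsilon>" and k: "\<And>x. \<epsilon> x * k = k * \<epsilon> x"
  shows "k \<in> range \<epsilon>"
proof -
  interpret etale_embedding_pair sA sE \<epsilon> \<epsilon>
    by fact
  obtain h where h: "\<And>x. \<epsilon> x * h = h * \<epsilon> x"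
    "\<And>k. \<forall>x. \<epsilon> x * k = k * \<epsilon> x \<Longrightarrow> \<exists>x. k = \<epsilon> x * h"
    using unit_intertwiner by blast
  obtain x where x: "1 = \<epsilon> x * h"
    using h(2)[of 1] by auto
  have "y = 0" if "x * y = 0" for y
  proof -
    have "\<epsilon> y * \<epsilon> x = 0"
      using that hom(6)[of y x] by (simp add: mult.commute)
    then have "\<epsilon> y * (\<epsilon> x * h) = 0"
      by (simp flip: mult.assoc)
    then show ?thesis
      by (simp add: hom_eq_zero flip: x)
  qed
  then obtain x' where x': "x * x' = 1"
    using E.injective_mult_imp_unit[OF E.finite_dimensional] by blast
  have "h = \<epsilon> (x' * x) * h"
    using x' by (simp only: mult.commute[of x'] hom mult_1)
  also have "\<dots> = \<epsilon> x'"
    by (simp add: mult.assoc flip: x)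
  finally have "h = \<epsilon> x'" .
  moreover obtain y where "k = \<epsilon> y * h"
    using h(2) k by blast
  ultimately show ?thesis
    by (metis hom(6) rangeI)
qed

subsection \<open>Algebras with involution\<close>

lemma unit_inverse_eq:
  assumes "x * y = 1" "y * x = 1" shows "unit_inverse x = y"
  unfolding unit_inverse_def
proof (rule the_equality)
  fix z assume "x * z = 1 \<and> z * x = 1"
  then show "z = y"
    using assms by (metis mult.assoc mult.left_neutral mult.right_neutral)
qed (use assms in blast)

theorem theorem3p2:
  fixes sA :: "'l::field \<Rightarrow> 'a::ring_1 \<Rightarrow> 'a"
    and sE :: "'l \<Rightarrow> 'e::comm_ring_1 \<Rightarrow> 'e"
    and \<tau> :: "'a \<Rightarrow> 'a" and \<sigma> :: "'e \<Rightarrow> 'e"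
    and n :: nat and K :: "'l set" and F :: "'e set"
    and \<epsilon> :: "'e \<Rightarrow> 'a" and g :: 'a
    and \<theta> :: "'e \<Rightarrow> 'a \<Rightarrow> 'a"
  assumes A: "central_simple_algebra sA"
    and dim_A: "vector_space.dim sA UNIV = n ^ 2"
    and tau: "ring_involution \<tau>"
    and K: "K = {c. \<tau> (sA c 1) = sA c 1}"
    and char: "(\<forall>c. \<tau> (sA c 1) = sA c 1) \<Longrightarrow> CHAR('l) \<noteq> 2"
    and E: "etale_algebra sE"
    and dim_E: "vector_space.dim sE UNIV = n"
    and sigma: "ring_automorphism \<sigma>"
    and sigma_order: "\<sigma> \<circ> \<sigma> = id" "\<sigma> \<noteq> id"
    and sigma_L: "\<sigma> ` range (\<lambda>c. sE c 1) = range (\<lambda>c. sE c 1)"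
    and sigma_tau_L: "\<And>c d. \<sigma> (sE c 1) = sE d 1 \<longleftrightarrow> \<tau> (sA c 1) = sA d 1"
    and F: "F = fixed_set \<sigma>"
    and I1: "has_dim_over sE K F
               (if \<forall>c. \<sigma> (sE c 1) = sE c 1 then (n + 1) div 2 else n)"
    and eps: "algebra_embedding sE sA \<epsilon>"
    and g: "g \<in> units_of_subring UNIV" "\<tau> g = g"
    and eps_sigma: "\<And>x. \<epsilon> (\<sigma> x) = unit_inverse g * \<tau> (\<epsilon> x) * g"
    and theta: "\<And>a. a \<in> units_of_subring F \<Longrightarrow> \<theta> a = \<tau> \<circ> Int_conj (g * \<epsilon> a)"
  shows "((\<exists>\<iota>. embedding_with_involution sE \<sigma> sA \<tau> \<iota>) \<longleftrightarrow>
            (\<exists>a \<in> units_of_subring F. isomorphic_with_involution sA (\<theta> a) sA \<tau>)) \<and>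
         ((\<exists>a \<in> units_of_subring F. isomorphic_with_involution sA (\<theta> a) sA \<tau>) \<longleftrightarrow>
            (\<exists>b \<in> units_of_subring F. \<exists>h \<in> units_of_subring UNIV. g * \<epsilon> b = \<tau> h * h))"
proof -
  interpret A: central_simple_algebra sA by fact
  interpret E: etale_algebra sE by fact
  have pair: "etale_embedding_pair sA sE \<iota> \<epsilon>" if "algebra_embedding sE sA \<iota>" for \<iota>
    using that eps dim_A dim_E by unfold_locales auto
  have tau_add: "\<tau> (x + y) = \<tau> x + \<tau> y" and tau_mult: "\<tau> (x * y) = \<tau> y * \<tau> x"
    and tau_tau: "\<tau> (\<tau> x) = x" for x y
    using tau by (auto simp: ring_involution_def)
  have tau_1: "\<tau> 1 = 1"
    using tau_mult[of "\<tau> 1" 1] tau_tau[of 1] by simp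
  have hom: "\<epsilon> (x * y) = \<epsilon> x * \<epsilon> y" "\<epsilon> 1 = 1" for x y
    using eps by (auto simp: algebra_embedding_def algebra_hom_def)
  have eps_inj: "\<epsilon> x = \<epsilon> y \<longleftrightarrow> x = y" for x y
    using eps by (auto simp: algebra_embedding_def inj_eq)
  have sigma_mult: "\<sigma> (x * y) = \<sigma> x * \<sigma> y" and sigma_1: "\<sigma> 1 = 1"
    and sigma_sigma: "\<sigma> (\<sigma> x) = x" for x y
    using sigma sigma_order(1) by (auto simp: ring_automorphism_def fun_eq_iff)
  obtain gi where gi: "g * gi = 1" "gi * g = 1"
    using g(1) by (auto simp: units_of_subring_def)
  have g_eps_sigma: "g * \<epsilon> (\<sigma> x) = \<tau> (\<epsilon> x) * g" for x
    using gi by (simp add: eps_sigma unit_inverse_eq[OF gi] flip: mult.assoc)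
  \<comment> \<open>Since u = g \<epsilon>(a) is fixed by \<tau>, so is its inverse u', and \<tau>(u
    z u') = u' \<tau>(z) u.\<close>
  have twist: "\<exists>u'. g * \<epsilon> a * u' = 1 \<and> u' * (g * \<epsilon> a) = 1 \<and> (\<forall>z. \<theta> a z = u' * \<tau> z * (g * \<epsilon> a))"
    if a: "a \<in> units_of_subring F" for a
  proof -
    obtain b where b: "a * b = 1" "\<sigma> a = a"
      using a F by (auto simp: units_of_subring_def fixed_set_def)
    define u where "u = g * \<epsilon> a"
    define u' where "u' = \<epsilon> b * gi"
    have "\<epsilon> a * \<epsilon> b = 1" "\<epsilon> b * \<epsilon> a = 1"
      using b(1) hom by (metis mult.commute)+
    then have u': "u * u' = 1" "u' * u = 1"
      using gi by (simp_all add: u_def u'_def) (metis mult.assoc mult.left_neutral)+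
    have tau_u: "\<tau> u = u"
      using g_eps_sigma[of a] by (simp add: u_def tau_mult tau_tau g(2) b(2))
    have "\<tau> u' * u = 1"
      using arg_cong[OF u'(1), of \<tau>] by (simp add: tau_mult tau_u tau_1)
    then have tau_u': "\<tau> u' = u'"
      using u'(1) by (metis mult.assoc mult.left_neutral mult.right_neutral)
    have "\<theta> a z = u' * \<tau> z * u" for z
      using theta[OF a] unit_inverse_eq[OF u']
      by (simp add: Int_conj_def tau_mult tau_u tau_u' mult.assoc flip: u_def)
    then show ?thesis
      using u' by (auto simp: u_def)
  qed
  have ii_i: "\<exists>\<iota>. embedding_with_involution sE \<sigma> sA \<tau> \<iota>"
    if a: "a \<in> units_of_subring F" and iso: "isomorphic_with_involution sA (\<theta> a) sA \<tau>" for a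
  proof -
    obtain f where f: "algebra_hom sA sA f" "bij f" "f \<circ> \<theta> a = \<tau> \<circ> f"
      using iso by (auto simp: isomorphic_with_involution_def)
    obtain u' where u': "u' * (g * \<epsilon> a) = 1" "\<And>z. \<theta> a z = u' * \<tau> z * (g * \<epsilon> a)"
      using twist[OF a] by blast
    \<comment> \<open>As u' inverts g \<epsilon>(a) and E is commutative, the factor
      \<open>a\<close> cancels.\<close>
    have theta_eps: "\<theta> a (\<epsilon> x) = \<epsilon> (\<sigma> x)" for x
    proof -
      have "\<theta> a (\<epsilon> x) = u' * (\<tau> (\<epsilon> x) * g) * \<epsilon> a"
        by (simp add: u'(2) mult.assoc)
      also have "\<dots> = u' * g * (\<epsilon> (\<sigma> x * a))"
        by (simp add: hom mult.assoc flip: g_eps_sigma)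
      also have "\<dots> = u' * (g * \<epsilon> a) * \<epsilon> (\<sigma> x)"
        by (simp add: mult.commute[of "\<sigma> x"] hom mult.assoc)
      finally show ?thesis
        by (simp add: u'(1))
    qed
    have "f (\<epsilon> (\<sigma> x)) = \<tau> (f (\<epsilon> x))" for x
      using fun_cong[OF f(3), of "\<epsilon> x"] by (simp add: theta_eps)
    then have "(f \<circ> \<epsilon>) \<circ> \<sigma> = \<tau> \<circ> (f \<circ> \<epsilon>)"
      by (simp add: fun_eq_iff)
    moreover have "algebra_embedding sE sA (f \<circ> \<epsilon>)"
      using eps f(1,2) Vector_Spaces.linear_compose[of sE sA \<epsilon> sA f]
      by (auto simp: algebra_embedding_def algebra_hom_def intro: inj_compose bij_is_inj)
    ultimately show ?thesis
      unfolding embedding_with_involution_def by blast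
  qed
  have iii_ii: "isomorphic_with_involution sA (\<theta> b) sA \<tau>"
    if b: "b \<in> units_of_subring F" and h: "h \<in> units_of_subring UNIV" "g * \<epsilon> b = \<tau> h * h" for b h
  proof -
    obtain h' where h': "h * h' = 1" "h' * h = 1"
      using h(1) by (auto simp: units_of_subring_def)
    obtain u' where u': "g * \<epsilon> b * u' = 1" "u' * (g * \<epsilon> b) = 1"
      "\<And>z. \<theta> b z = u' * \<tau> z * (g * \<epsilon> b)"
      using twist[OF b] by blast
    have tau_h': "\<tau> h' * \<tau> h = 1" "\<tau> h * \<tau> h' = 1"
      using h' by (simp_all add: tau_1 flip: tau_mult)
    \<comment> \<open>The inverse u' of \<tau>(h) h turns h u' into the inverse of
      \<tau>(h).\<close>
    have "\<tau> h * (h * u') = 1"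
      using u'(1) by (simp add: h(2) mult.assoc)
    then have hu': "h * u' = \<tau> h'"
      using tau_h'(1) by (metis mult.assoc mult.left_neutral mult.right_neutral)
    define f where "f = (\<lambda>z. h * z * h')"
    have "Vector_Spaces.linear sA sA ((\<lambda>z. z * h') \<circ> (\<lambda>z. h * z))"
      by (rule Vector_Spaces.linear_compose[OF A.linear_mult_left A.linear_mult_right])
    then have "algebra_hom sA sA f"
      using h' by (auto simp: algebra_hom_def f_def comp_def)
        (metis mult.assoc mult.left_neutral)
    moreover have "bij f"
    proof (rule bijI')
      show "f x = f y \<longleftrightarrow> x = y" for x y
        unfolding f_def using h' by (metis mult.assoc mult.left_neutral mult.right_neutral)
      show "\<exists>x. y = f x" for y
        unfolding f_def using h'
        by (intro exI[of _ "h' * y * h"]) (metis mult.assoc mult.left_neutral mult.right_neutral)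
    qed
    moreover have "f (\<theta> b z) = \<tau> (f z)" for z
    proof -
      have "f (\<theta> b z) = (h * u') * \<tau> z * \<tau> h * (h * h')"
        by (simp add: f_def u'(3) h(2) mult.assoc)
      then show ?thesis
        by (simp add: hu' h'(1) f_def tau_mult mult.assoc)
    qed
    ultimately show ?thesis
      unfolding isomorphic_with_involution_def by (intro exI[of _ f]) (simp add: fun_eq_iff)
  qed
  have i_iii: "\<exists>b \<in> units_of_subring F. \<exists>h \<in> units_of_subring UNIV. g * \<epsilon> b = \<tau> h * h"
    if "embedding_with_involution sE \<sigma> sA \<tau> \<iota>" for \<iota>
  proof -
    have iota: "algebra_embedding sE sA \<iota>" "\<And>x. \<iota> (\<sigma> x) = \<tau> (\<iota> x)"
      using that by (auto simp: embedding_with_involution_def fun_eq_iff)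
    obtain h h' where h: "\<forall>x. \<iota> x * h = h * \<epsilon> x" "h * h' = 1" "h' * h = 1"
      using etale_embedding_pair.unit_intertwiner[OF pair[OF iota(1)]] by blast
    define u where "u = \<tau> h * h"
    \<comment> \<open>This element will be \<epsilon>(b). Its inverse \<open>y'\<close> is carried
      along so that the inverse of \<open>b\<close> is obtained in E as well.\<close>
    define y where "y = gi * u"
    define y' where "y' = h' * \<tau> h' * g"
    have tau_h': "\<tau> h' * \<tau> h = 1" "\<tau> h * \<tau> h' = 1"
      using h(2,3) by (simp_all add: tau_1 flip: tau_mult)
    have gy: "g * y = u"
      by (simp add: y_def gi flip: mult.assoc)
    have yy': "y * y' = 1" "y' * y = 1"
      unfolding y_def y'_def u_def using gi h(2,3) tau_h'
      by (metis mult.assoc mult.left_neutral)+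
    have comm: "\<epsilon> w * y = y * \<epsilon> w" for w
    proof -
      \<comment> \<open>Writing \<open>w\<close> as \<sigma>(x) allows g \<epsilon>(w) to be
        replaced by \<tau>(\<epsilon>(x)) g.\<close>
      define x where "x = \<sigma> w"
      have w: "w = \<sigma> x"
        by (simp add: x_def sigma_sigma)
      have "u * \<epsilon> w = \<tau> h * (\<iota> w * h)"
        using h(1) by (simp add: u_def mult.assoc)
      also have "\<dots> = \<tau> (\<iota> x * h) * h"
        by (simp add: w iota(2) tau_mult mult.assoc)
      also have "\<dots> = \<tau> (\<epsilon> x) * u"
        using h(1) by (simp add: tau_mult u_def mult.assoc)
      finally have "g * (y * \<epsilon> w) = \<tau> (\<epsilon> x) * g * y"
        by (simp add: mult.assoc gy flip: gy)
      also have "\<dots> = g * (\<epsilon> w * y)"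
        by (simp add: w mult.assoc flip: g_eps_sigma)
      finally have "gi * g * (y * \<epsilon> w) = gi * g * (\<epsilon> w * y)"
        by (simp add: mult.assoc)
      then show ?thesis
        by (simp add: gi)
    qed
    have comm': "\<epsilon> w * y' = y' * \<epsilon> w" for w
      using comm[of w] yy' by (metis mult.assoc mult.left_neutral mult.right_neutral)
    obtain b b' where b: "y = \<epsilon> b" "y' = \<epsilon> b'"
      using centralizer_eq_range[OF pair[OF eps]] comm comm' by blast
    have "\<epsilon> (b * b') = \<epsilon> 1"
      using yy'(1) by (simp add: hom b)
    then have bb': "b * b' = 1"
      by (simp only: eps_inj)
    \<comment> \<open>Both \<open>g\<close> and g \<epsilon>(b) = \<tau>(h) h are fixed by \<tau>,
      which forces \<sigma>(b) = b.\<close>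
    have "g * \<epsilon> (\<sigma> b) = \<tau> (g * \<epsilon> b)"
      by (simp add: g_eps_sigma tau_mult g(2))
    also have "\<dots> = g * \<epsilon> b"
      using gy by (simp add: b(1) u_def tau_mult tau_tau)
    finally have "gi * g * \<epsilon> (\<sigma> b) = gi * g * \<epsilon> b"
      by (simp add: mult.assoc)
    then have fixed: "\<sigma> b = b"
      by (simp add: gi eps_inj)
    \<comment> \<open>A unit of F must have its inverse in F, so \<open>b'\<close> has to be fixed
      by \<sigma> too.\<close>
    have "b * \<sigma> b' = 1"
      using sigma_mult[of b b'] by (simp add: fixed bb' sigma_1)
    then have "\<sigma> b' = b'"
      using bb' by (metis mult.assoc mult.commute mult.right_neutral)
    then have "b \<in> units_of_subring F"
      using fixed bb' by (auto simp: units_of_subring_def F fixed_set_def mult.commute)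
    moreover have "h \<in> units_of_subring UNIV"
      using h(2,3) by (auto simp: units_of_subring_def)
    moreover have "g * \<epsilon> b = \<tau> h * h"
      using gy by (simp add: b(1) u_def)
    ultimately show ?thesis
      by blast
  qed
  show ?thesis
    using ii_i iii_ii i_iii by blast
qed

end
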